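(* Let $E$ be a Banach space satisfying any of the following assumptions: (1) $E$ has property $(V)$ and is not Grothendieck, (2) $E$ is non-reflexive and $E^*$ has property $(V^* )$, (3) $E$ is non-reflexive and $E^*$ is separable. Then $\mathrm{Lip}_0(E)$ is not a Grothendieck space.
   Context: All vector spaces are real. A Banach space $X$ is Grothendieck (a Grothendieck space) if every weak* convergent sequence in $X^*$ converges weakly. A series $\sum_n x_n$ in a Banach space $X$ is weakly unconditionally Cauchy (wuC) if $\sum_n|x^*(x_n)|<\infty$ for every $x^*\in X^*$. $X$ has property $(V)$ if every set $K\subseteq X^*$ such that $\lim_n\sup_{x^*\in K}|x^*(x_n)|=0$ for every wuC series $\sum_n x_n$ in $X$ is relatively weakly compact in $X^*$. $X$ has property $(V^* )$ if every set $K\subseteq X$ such that $\lim_n\sup_{x\in K}|x_n^*(x)|=0$ for every wuC series $\sum_n x_n^*$ in $X^*$ is relatively weakly compact in $X$. For a Banach space $E$ regarded as a metric space with a base point $e$ (e.g. $e=0$), $\mathrm{Lip}_0(E)$ is the Banach space of all Lipschitz functions $f\colon E\to\mathbb{R}$ with $f(e)=0$, with norm $\|f\|=\mathrm{Lip}(f)=\sup_{x\neq y}|f(x)-f(y)|/\|x-y\|$. *)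

theory Defs
  imports "HOL-Analysis.Analysis"
begin

section \<open>Weak and weak* topologies\<close>

text \<open>The dual of \<^typ>\<open>'a\<close> is the type \<^typ>\<open>'a \<Rightarrow>\<^sub>L real\<close> of bounded functionals with the operator norm.
  The topology \<^term>\<open>euclidean\<close> on a function type is the product topology, so both topologies
  below are topologies of pointwise convergence.  The weak* topology is the strong operator
  topology for scalar-valued operators.\<close>

definition weak_topology :: "'a::real_normed_vector topology" where
  "weak_topology = pullback_topology UNIV (\<lambda>x (f :: 'a \<Rightarrow>\<^sub>L real). blinfun_apply f x) euclidean"

definition weak_star_topology :: "('a::real_normed_vector \<Rightarrow>\<^sub>L real) topology" where
  "weak_star_topology = strong_operator_topology"

definition relatively_weakly_compact :: "'a::real_normed_vector set \<Rightarrow> bool" where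
  "relatively_weakly_compact K \<longleftrightarrow> compactin weak_topology (weak_topology closure_of K)"

section \<open>Properties of Banach spaces\<close>

definition grothendieck_space :: "'a::banach itself \<Rightarrow> bool" where
  "grothendieck_space (_ :: 'a itself) \<longleftrightarrow>
    (\<forall>f :: nat \<Rightarrow> ('a \<Rightarrow>\<^sub>L real).
      (\<exists>l. limitin weak_star_topology f l sequentially) \<longrightarrow>
      (\<exists>l. limitin weak_topology f l sequentially))"

definition wuC :: "(nat \<Rightarrow> 'a::banach) \<Rightarrow> bool" where
  "wuC x \<longleftrightarrow> (\<forall>f :: 'a \<Rightarrow>\<^sub>L real. summable (\<lambda>n. \<bar>blinfun_apply f (x n)\<bar>))"

text \<open>The suprema in the next two definitions are taken in \<^typ>\<open>ennreal\<close>, so that they are infinite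
  for unbounded sets and zero for the empty set.\<close>

definition property_V :: "'a::banach itself \<Rightarrow> bool" where
  "property_V (_ :: 'a itself) \<longleftrightarrow>
    (\<forall>K :: ('a \<Rightarrow>\<^sub>L real) set.
      (\<forall>x :: nat \<Rightarrow> 'a. wuC x \<longrightarrow> (\<lambda>n. SUP f\<in>K. ennreal \<bar>blinfun_apply f (x n)\<bar>) \<longlonglongrightarrow> 0) \<longrightarrow>
      relatively_weakly_compact K)"

definition property_V_star :: "'a::banach itself \<Rightarrow> bool" where
  "property_V_star (_ :: 'a itself) \<longleftrightarrow>
    (\<forall>K :: 'a set.
      (\<forall>f :: nat \<Rightarrow> ('a \<Rightarrow>\<^sub>L real). wuC f \<longrightarrow> (\<lambda>n. SUP x\<in>K. ennreal \<bar>blinfun_apply (f n) x\<bar>) \<longlonglongrightarrow> 0) \<longrightarrow>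
      relatively_weakly_compact K)"

lift_definition canonical_embedding :: "'a::real_normed_vector \<Rightarrow> (('a \<Rightarrow>\<^sub>L real) \<Rightarrow>\<^sub>L real)"
  is "\<lambda>x f. blinfun_apply f x"
  by (rule bounded_linear_intros)+

definition reflexive_space :: "'a::banach itself \<Rightarrow> bool" where
  "reflexive_space (_ :: 'a itself) \<longleftrightarrow>
    surj (canonical_embedding :: 'a \<Rightarrow> (('a \<Rightarrow>\<^sub>L real) \<Rightarrow>\<^sub>L real))"

section \<open>The space of Lipschitz functions vanishing at the base point\<close>

text \<open>Because of \<open>r / 0 = 0\<close>, the pairs with \<open>x = y\<close> contribute only the value 0 to the supremum;
  they keep the set nonempty on a one-point space.\<close>

definition lipschitz_number :: "('a::metric_space \<Rightarrow> real) \<Rightarrow> real" where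
  "lipschitz_number f = (SUP (x, y). \<bar>f x - f y\<bar> / dist x y)"

lemma lipschitz_number_bdd:
  fixes f :: "'a::metric_space \<Rightarrow> real"
  assumes "C-lipschitz_on UNIV f"
  shows "bdd_above (range (\<lambda>(x, y). \<bar>f x - f y\<bar> / dist x y))"
    and "lipschitz_number f \<le> C"
proof -
  have *: "\<bar>f x - f y\<bar> / dist x y \<le> C" for x y
    using assms lipschitz_onD[OF assms, of x y] lipschitz_on_nonneg[OF assms]
    by (cases "x = y") (auto simp: dist_real_def divide_simps)
  show "bdd_above (range (\<lambda>(x, y). \<bar>f x - f y\<bar> / dist x y))"
    using * by (intro bdd_aboveI[of _ C]) auto
  show "lipschitz_number f \<le> C"
    unfolding lipschitz_number_def using * by (intro cSUP_least) auto
qed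

lemma lipschitz_number_upper:
  fixes f :: "'a::metric_space \<Rightarrow> real"
  assumes "C-lipschitz_on UNIV f"
  shows "\<bar>f x - f y\<bar> \<le> lipschitz_number f * dist x y"
    and "0 \<le> lipschitz_number f"
proof -
  have *: "\<bar>f x - f y\<bar> / dist x y \<le> lipschitz_number f" for x y
    unfolding lipschitz_number_def
    using cSUP_upper[OF _ lipschitz_number_bdd(1)[OF assms], of "(x, y)"] by simp
  show "\<bar>f x - f y\<bar> \<le> lipschitz_number f * dist x y"
    using *[of x y] by (cases "x = y") (auto simp: divide_simps)
  show "0 \<le> lipschitz_number f"
    using *[of x x] by simp
qed

text \<open>The base point is 0.\<close>

typedef (overloaded) 'a lip0 =
  "{f :: 'a::{metric_space, zero} \<Rightarrow> real. (\<exists>C. C-lipschitz_on UNIV f) \<and> f 0 = 0}"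
  morphisms lip0_apply Lip0
  by (rule exI[of _ "\<lambda>_. 0"]) (auto intro!: exI[of _ 0] lipschitz_onI)

setup_lifting type_definition_lip0

lemma lip0_lipschitz: "\<exists>C. C-lipschitz_on UNIV (lip0_apply f)"
  using lip0_apply[of f] by simp

lemma lip0_zero [simp]: "lip0_apply f 0 = 0"
  using lip0_apply[of f] by simp

instantiation lip0 :: ("{metric_space, zero}") real_normed_vector
begin

lift_definition zero_lip0 :: "'a lip0" is "\<lambda>_. 0"
  by (auto intro!: exI[of _ 0] lipschitz_onI)

lift_definition plus_lip0 :: "'a lip0 \<Rightarrow> 'a lip0 \<Rightarrow> 'a lip0" is "\<lambda>f g x. f x + g x"
  by (auto intro: lipschitz_on_add)

lift_definition uminus_lip0 :: "'a lip0 \<Rightarrow> 'a lip0" is "\<lambda>f x. - f x"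
  by auto

lift_definition minus_lip0 :: "'a lip0 \<Rightarrow> 'a lip0 \<Rightarrow> 'a lip0" is "\<lambda>f g x. f x - g x"
  by (auto intro: lipschitz_on_diff)

lift_definition scaleR_lip0 :: "real \<Rightarrow> 'a lip0 \<Rightarrow> 'a lip0" is "\<lambda>r f x. r * f x"
  by (auto intro: lipschitz_on_cmult_real)

lift_definition norm_lip0 :: "'a lip0 \<Rightarrow> real" is lipschitz_number .

definition dist_lip0 :: "'a lip0 \<Rightarrow> 'a lip0 \<Rightarrow> real" where
  "dist_lip0 f g = norm (f - g)"

definition sgn_lip0 :: "'a lip0 \<Rightarrow> 'a lip0" where
  "sgn_lip0 f = inverse (norm f) *\<^sub>R f"

definition uniformity_lip0 :: "('a lip0 \<times> 'a lip0) filter" where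
  "uniformity_lip0 = (INF e\<in>{0 <..}. principal {(f, g). dist f g < e})"

definition open_lip0 :: "'a lip0 set \<Rightarrow> bool" where
  "open_lip0 S = (\<forall>f\<in>S. \<forall>\<^sub>F (f', g) in uniformity. f' = f \<longrightarrow> g \<in> S)"

lemma norm_lip0_upper:
  fixes f :: "'a lip0"
  shows "\<bar>lip0_apply f x - lip0_apply f y\<bar> \<le> norm f * dist x y"
  by transfer (auto dest: lipschitz_number_upper)

lemma norm_lip0_least:
  fixes f :: "'a lip0"
  assumes "C-lipschitz_on UNIV (lip0_apply f)"
  shows "norm f \<le> C"
  using assms by transfer (rule lipschitz_number_bdd(2))

lemma norm_lip0_nonneg: "0 \<le> norm (f :: 'a lip0)"
  by transfer (auto dest: lipschitz_number_upper)

instance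
proof
  fix f g h :: "'a lip0" and r s :: real
  show "f + g + h = f + (g + h)" by transfer (simp add: add.assoc)
  show "f + g = g + f" by transfer (simp add: add.commute)
  show "0 + f = f" by transfer simp
  show "- f + f = 0" by transfer simp
  show "f - g = f + - g" by transfer simp
  show "r *\<^sub>R (f + g) = r *\<^sub>R f + r *\<^sub>R g" by transfer (simp add: algebra_simps)
  show "(r + s) *\<^sub>R f = r *\<^sub>R f + s *\<^sub>R f" by transfer (simp add: algebra_simps)
  show "r *\<^sub>R s *\<^sub>R f = (r * s) *\<^sub>R f" by transfer (simp add: algebra_simps)
  show "1 *\<^sub>R f = f" by transfer simp
  show "dist f g = norm (f - g)" by (rule dist_lip0_def)
  show "sgn f = inverse (norm f) *\<^sub>R f" by (rule sgn_lip0_def)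
  show "uniformity = (INF e\<in>{0<..}. principal {(f, g :: 'a lip0). dist f g < e})"
    by (rule uniformity_lip0_def)
  show "open S \<longleftrightarrow> (\<forall>f\<in>S. \<forall>\<^sub>F (f', g) in uniformity. f' = f \<longrightarrow> g \<in> S)" for S :: "'a lip0 set"
    by (rule open_lip0_def)
  show "norm f = 0 \<longleftrightarrow> f = 0"
  proof
    assume "norm f = 0"
    then have "lip0_apply f x = 0" for x
      using norm_lip0_upper[of f x 0] by simp
    then show "f = 0" by transfer auto
  next
    assume "f = 0"
    then have "0-lipschitz_on UNIV (lip0_apply f)"
      by (auto intro!: lipschitz_onI simp: zero_lip0.rep_eq)
    then show "norm f = 0"
      using norm_lip0_least[of 0 f] norm_lip0_nonneg[of f] by simp
  qed
  have "\<bar>lip0_apply (f + g) x - lip0_apply (f + g) y\<bar> \<le> (norm f + norm g) * dist x y" for x y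
    using norm_lip0_upper[of f x y] norm_lip0_upper[of g x y]
    by (simp add: plus_lip0.rep_eq distrib_right)
  then show "norm (f + g) \<le> norm f + norm g"
    by (intro norm_lip0_least lipschitz_onI)
      (auto simp: dist_real_def norm_lip0_nonneg add_nonneg_nonneg)
  have scale: "norm (t *\<^sub>R h) \<le> \<bar>t\<bar> * norm h" for t and h :: "'a lip0"
  proof (intro norm_lip0_least lipschitz_onI)
    fix x y
    have "\<bar>lip0_apply (t *\<^sub>R h) x - lip0_apply (t *\<^sub>R h) y\<bar>
        = \<bar>t\<bar> * \<bar>lip0_apply h x - lip0_apply h y\<bar>"
      by (simp add: scaleR_lip0.rep_eq abs_mult flip: right_diff_distrib)
    also have "\<dots> \<le> \<bar>t\<bar> * (norm h * dist x y)"
      by (intro mult_left_mono norm_lip0_upper) auto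
    finally show "dist (lip0_apply (t *\<^sub>R h) x) (lip0_apply (t *\<^sub>R h) y) \<le> \<bar>t\<bar> * norm h * dist x y"
      by (simp add: dist_real_def mult.assoc)
  qed (simp add: norm_lip0_nonneg)
  show "norm (r *\<^sub>R f) = \<bar>r\<bar> * norm f"
  proof (cases "r = 0")
    case True
    then show ?thesis using scale[of r f] norm_lip0_nonneg[of "r *\<^sub>R f"] by simp
  next
    case False
    have "inverse r *\<^sub>R (r *\<^sub>R f) = f" using False by transfer (auto simp: mult.assoc[symmetric])
    then have "norm f \<le> inverse \<bar>r\<bar> * norm (r *\<^sub>R f)"
      using scale[of "inverse r" "r *\<^sub>R f"] by simp
    then have "\<bar>r\<bar> * norm f \<le> norm (r *\<^sub>R f)"
      using False by (simp add: field_simps)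
    with scale[of r f] show ?thesis by simp
  qed
qed

end

instance lip0 :: ("{metric_space, zero}") banach
proof
  fix X :: "nat \<Rightarrow> 'a lip0"
  assume X: "Cauchy X"
  have ptw: "\<bar>lip0_apply (X m) x - lip0_apply (X n) x\<bar> \<le> norm (X m - X n) * dist x 0" for m n x
    using norm_lip0_upper[of "X m - X n" x 0] by (simp add: minus_lip0.rep_eq)
  have "Cauchy (\<lambda>n. lip0_apply (X n) x)" for x
  proof (rule metric_CauchyI)
    fix e :: real
    assume "0 < e"
    then have "0 < e / (dist x 0 + 1)" by (simp add: add_nonneg_pos)
    then obtain N where N: "\<And>m n. m \<ge> N \<Longrightarrow> n \<ge> N \<Longrightarrow> dist (X m) (X n) < e / (dist x 0 + 1)"
      using X unfolding Cauchy_def by meson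
    have "dist (lip0_apply (X m) x) (lip0_apply (X n) x) < e" if "m \<ge> N" "n \<ge> N" for m n
    proof -
      have "norm (X m - X n) * (dist x 0 + 1) < e"
        using N[OF that] by (simp add: dist_norm pos_less_divide_eq add_nonneg_pos)
      moreover have "norm (X m - X n) * dist x 0 \<le> norm (X m - X n) * (dist x 0 + 1)"
        by (intro mult_left_mono) auto
      ultimately show ?thesis using ptw[of m x n] by (simp add: dist_real_def)
    qed
    then show "\<exists>N. \<forall>m\<ge>N. \<forall>n\<ge>N. dist (lip0_apply (X m) x) (lip0_apply (X n) x) < e" by blast
  qed
  then have "\<forall>x. \<exists>l. (\<lambda>n. lip0_apply (X n) x) \<longlonglongrightarrow> l"
    by (auto simp: Cauchy_convergent_iff convergent_def)
  then obtain g where g: "\<And>x. (\<lambda>n. lip0_apply (X n) x) \<longlonglongrightarrow> g x"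
    by metis
  obtain B where B: "\<And>n. norm (X n) \<le> B"
    using Cauchy_Bseq[OF X] by (auto simp: Bseq_def)
  have "B-lipschitz_on UNIV g"
  proof (rule lipschitz_onI)
    fix x y
    have "\<bar>lip0_apply (X n) x - lip0_apply (X n) y\<bar> \<le> B * dist x y" for n
      using norm_lip0_upper[of "X n" x y] mult_right_mono[OF B[of n], of "dist x y"] by simp
    then have "\<bar>g x - g y\<bar> \<le> B * dist x y"
      by (intro LIMSEQ_le_const2[OF tendsto_rabs[OF tendsto_diff[OF g g]]]) auto
    then show "dist (g x) (g y) \<le> B * dist x y" by (simp add: dist_real_def)
  next
    show "0 \<le> B" using B[of 0] norm_ge_zero[of "X 0"] by linarith
  qed
  moreover have "g 0 = 0"
    using LIMSEQ_unique[OF g[of 0]] by simp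
  ultimately have G: "lip0_apply (Lip0 g) = g"
    by (intro Lip0_inverse) auto
  have "X \<longlonglongrightarrow> Lip0 g"
  proof (rule metric_LIMSEQ_I)
    fix e :: real
    assume "0 < e"
    then have "0 < e / 2" by simp
    then obtain N where N: "\<And>m n. m \<ge> N \<Longrightarrow> n \<ge> N \<Longrightarrow> dist (X m) (X n) < e / 2"
      using X unfolding Cauchy_def by meson
    have "dist (X m) (Lip0 g) < e" if "m \<ge> N" for m
    proof -
      have "(e / 2)-lipschitz_on UNIV (lip0_apply (X m - Lip0 g))"
      proof (rule lipschitz_onI)
        fix x y
        have le: "\<bar>(lip0_apply (X m) x - lip0_apply (X n) x) - (lip0_apply (X m) y - lip0_apply (X n) y)\<bar>
            \<le> e / 2 * dist x y" if "n \<ge> N" for n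
        proof -
          have "norm (X m - X n) * dist x y \<le> e / 2 * dist x y"
            using N[OF \<open>m \<ge> N\<close> that] by (intro mult_right_mono) (auto simp: dist_norm)
          with norm_lip0_upper[of "X m - X n" x y] show ?thesis
            by (simp add: minus_lip0.rep_eq)
        qed
        have "(\<lambda>n. \<bar>(lip0_apply (X m) x - lip0_apply (X n) x) - (lip0_apply (X m) y - lip0_apply (X n) y)\<bar>)
            \<longlonglongrightarrow> \<bar>(lip0_apply (X m) x - g x) - (lip0_apply (X m) y - g y)\<bar>"
          by (intro tendsto_intros g)
        then have "\<bar>(lip0_apply (X m) x - g x) - (lip0_apply (X m) y - g y)\<bar> \<le> e / 2 * dist x y"
          by (rule LIMSEQ_le_const2) (use le in blast)
        then show "dist (lip0_apply (X m - Lip0 g) x) (lip0_apply (X m - Lip0 g) y) \<le> e / 2 * dist x y"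
          by (simp add: dist_real_def minus_lip0.rep_eq G)
      qed (use \<open>0 < e\<close> in simp)
      then have "norm (X m - Lip0 g) \<le> e / 2" by (rule norm_lip0_least)
      with \<open>0 < e\<close> show ?thesis by (simp add: dist_norm)
    qed
    then show "\<exists>N. \<forall>m\<ge>N. dist (X m) (Lip0 g) < e" by blast
  qed
  then show "convergent X" by (auto simp: convergent_def)
qed

text \<open>The choice of the base point is immaterial: subtracting the value at \<open>e\<close> is a linear isometry
  of \<^typ>\<open>'a lip0\<close> onto the space of Lipschitz functions vanishing at \<open>e\<close>.\<close>

lemma lip0_change_base_point:
  fixes e :: "'a::{metric_space, zero}"
  defines "T \<equiv> \<lambda>(f :: 'a lip0) x. lip0_apply f x - lip0_apply f e"
  shows "bij_betw T UNIV {f. (\<exists>C. C-lipschitz_on UNIV f) \<and> f e = 0}"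
    and "T (f + g) = (\<lambda>x. T f x + T g x)"
    and "T (r *\<^sub>R f) = (\<lambda>x. r * T f x)"
    and "lipschitz_number (T f) = norm f"
proof -
  have shift: "C-lipschitz_on UNIV (\<lambda>x. f x - c)" if "C-lipschitz_on UNIV f"
    for C c and f :: "'a \<Rightarrow> real"
    using that by (simp add: lipschitz_on_def dist_real_def)
  show "bij_betw T UNIV {f. (\<exists>C. C-lipschitz_on UNIV f) \<and> f e = 0}"
  proof (rule bij_betw_byWitness[where f' = "\<lambda>h. Lip0 (\<lambda>x. h x - h 0)"])
    show "\<forall>f\<in>UNIV. Lip0 (\<lambda>x. T f x - T f 0) = f"
      by (simp add: T_def lip0_apply_inverse)
    have inv: "lip0_apply (Lip0 (\<lambda>x. h x - h 0)) = (\<lambda>x. h x - h 0)"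
      if "\<exists>C. C-lipschitz_on UNIV h" for h :: "'a \<Rightarrow> real"
      using that shift by (intro Lip0_inverse) auto
    show "\<forall>h\<in>{f. (\<exists>C. C-lipschitz_on UNIV f) \<and> f e = 0}. T (Lip0 (\<lambda>x. h x - h 0)) = h"
      by (auto simp: T_def inv)
    show "T ` UNIV \<subseteq> {f. (\<exists>C. C-lipschitz_on UNIV f) \<and> f e = 0}"
      using lip0_lipschitz shift by (fastforce simp: T_def)
  qed auto
  show "T (f + g) = (\<lambda>x. T f x + T g x)"
    by (auto simp: T_def plus_lip0.rep_eq)
  show "T (r *\<^sub>R f) = (\<lambda>x. r * T f x)"
    by (auto simp: T_def scaleR_lip0.rep_eq algebra_simps)
  show "lipschitz_number (T f) = norm f"
    by (simp add: T_def lipschitz_number_def norm_lip0.rep_eq)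
qed

end

theory Submission
  imports Defs
begin

text \<open>
  Write \<open>J\<close> for the canonical embedding of a space into its bidual.  The proof compares
  \<open>Lip\<^sub>0(E)\<close> with the dual \<open>E*\<close> and derives each of the three cases from the Grothendieck
  property of \<open>E*\<close>.

  \<^item> The dual \<open>E*\<close> is a complemented subspace of \<open>Lip\<^sub>0(E)\<close>
    (\<open>dual_complemented_in_lip0\<close>): a Lipschitz function \<open>f\<close> is linearised by averaging its
    increments, \<open>(P f) x = M\<^sub>y (f (y + x) - f y)\<close>, where \<open>M\<close> is a
    translation invariant mean on the bounded functions on the abelian group \<open>E\<close>.  Invariance
    makes \<open>P f\<close> additive, and \<open>P\<close> fixes linear functionals because their differences are
    constant.  The Grothendieck property passes to complemented subspaces, so if
    \<open>Lip\<^sub>0(E)\<close> is Grothendieck, then \<open>E*\<close> is.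

  \<^item> In the dual of a Grothendieck space \<open>X\<close>, the terms of a wuC series tend to 0 in norm
    (\<open>grothendieck_wuC_dual_norm_tendsto_0\<close>).  All subseries of the wuC series converge weak*, hence
    weakly, and a gliding hump excludes this when the norms stay away from 0.

  Now let \<open>E*\<close> be Grothendieck.  If \<open>E\<close> has property \<open>(V)\<close>, the second fact for
  \<open>X = E*\<close>, applied to the images under \<open>J\<close> of wuC series in \<open>E\<close>, shows that every weak*
  convergent sequence in \<open>E*\<close> satisfies the test in \<open>(V)\<close>.  So it is relatively weakly compact and
  therefore converges weakly: \<open>E\<close> is Grothendieck.  If \<open>E*\<close> has property \<open>(V*)\<close>, the same
  fact shows that the unit ball of \<open>E*\<close> satisfies the test in \<open>(V*)\<close>, so it is relatively
  weakly compact and \<open>E\<close> is reflexive.  If \<open>E*\<close> is separable, then \<open>E*\<close> is a separable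
  Grothendieck space, hence reflexive, and so is \<open>E\<close>.

  Both reflexivity results rest on one observation (\<open>functional_outside_canonical_image\<close>): a
  functional \<open>\<psi>\<close> in \<open>X**\<close> outside \<open>J X\<close> is bounded below, on a suitable element of the unit
  ball of \<open>X*\<close>, even when that element has to vanish on a prescribed finite subset of \<open>X\<close>.
\<close>

section \<open>Hahn--Banach and uniform boundedness\<close>

text \<open>A partial functional is encoded by its graph, a subspace of \<open>'a \<times> real\<close>.  The bound by
  \<open>c * norm x\<close> forces such a subspace to be single-valued, so unions of chains and maximality
  concern plain subspaces only.\<close>

lemma hahn_banach_graph:
  fixes G\<^sub>0 :: "('a::real_normed_vector \<times> real) set"
  assumes G\<^sub>0: "subspace G\<^sub>0" and dom: "\<And>x r. (x, r) \<in> G\<^sub>0 \<Longrightarrow> r \<le> c * norm x" and c: "0 \<le> c"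
  shows "\<exists>f :: 'a \<Rightarrow>\<^sub>L real. (\<forall>(x, r)\<in>G\<^sub>0. blinfun_apply f x = r) \<and> norm f \<le> c"
proof -
  define \<A> where "\<A> = {G. subspace G \<and> G\<^sub>0 \<subseteq> G \<and> (\<forall>(x, r)\<in>G. r \<le> c * norm x)}"
  have "\<exists>M\<in>\<A>. \<forall>G\<in>\<A>. M \<subseteq> G \<longrightarrow> G = M"
  proof (rule subset_Zorn_nonempty)
    show "\<A> \<noteq> {}" using G\<^sub>0 dom by (auto simp: \<A>_def)
  next
    fix \<C> assume ne: "\<C> \<noteq> {}" and ch: "subset.chain \<A> \<C>"
    have sub: "\<C> \<subseteq> \<A>" and tot: "\<And>A B. A \<in> \<C> \<Longrightarrow> B \<in> \<C> \<Longrightarrow> A \<subseteq> B \<or> B \<subseteq> A"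
      using ch by (auto simp: subset.chain_def)
    have "subspace (\<Union>\<C>)"
    proof (rule subspaceI)
      obtain A where "A \<in> \<C>" using ne by blast
      then show "0 \<in> \<Union>\<C>" using sub subspace_0[of A] by (auto simp: \<A>_def)
    next
      fix p q assume "p \<in> \<Union>\<C>" "q \<in> \<Union>\<C>"
      then obtain A B where "A \<in> \<C>" "B \<in> \<C>" "p \<in> A" "q \<in> B" by auto
      with tot[of A B] obtain D where "D \<in> \<C>" "p \<in> D" "q \<in> D" by blast
      then show "p + q \<in> \<Union>\<C>" using sub by (auto simp: \<A>_def intro: subspace_add)
    next
      fix t :: real and p assume "p \<in> \<Union>\<C>"
      then show "t *\<^sub>R p \<in> \<Union>\<C>" using sub by (auto simp: \<A>_def intro: subspace_scale)
    qed
    then show "\<Union>\<C> \<in> \<A>" using ne sub by (fastforce simp: \<A>_def)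
  qed
  then obtain G where "G \<in> \<A>" and max: "\<And>H. H \<in> \<A> \<Longrightarrow> G \<subseteq> H \<Longrightarrow> H = G" by blast
  then have G: "subspace G" "G\<^sub>0 \<subseteq> G" and le: "\<And>x r. (x, r) \<in> G \<Longrightarrow> r \<le> c * norm x"
    by (auto simp: \<A>_def)
  have uniq: "r = s" if "(x, r) \<in> G" "(x, s) \<in> G" for x r s
    using le[of 0 "r - s"] le[of 0 "s - r"] subspace_diff[OF G(1) that] subspace_diff[OF G(1) that(2,1)]
    by simp
  have ex: "\<exists>r. (x\<^sub>0, r) \<in> G" for x\<^sub>0
  proof (rule ccontr)
    assume not: "\<nexists>r. (x\<^sub>0, r) \<in> G"
    \<comment> \<open>Any number between the two families of bounds is an admissible value at \<open>x\<^sub>0\<close>.\<close>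
    define \<alpha> where "\<alpha> = (SUP (x, r)\<in>G. r - c * norm (x - x\<^sub>0))"
    have gap: "r - c * norm (x - x\<^sub>0) \<le> c * norm (y + x\<^sub>0) - s" if "(x, r) \<in> G" "(y, s) \<in> G" for x r y s
    proof -
      have "r + s \<le> c * norm (x + y)" using le[of "x + y" "r + s"] subspace_add[OF G(1) that] by simp
      also have "\<dots> \<le> c * (norm (x - x\<^sub>0) + norm (y + x\<^sub>0))"
        using norm_triangle_ineq[of "x - x\<^sub>0" "y + x\<^sub>0"] c by (intro mult_left_mono) auto
      finally show ?thesis by (simp add: algebra_simps)
    qed
    have zero: "(0, 0) \<in> G" using subspace_0[OF G(1)] by (simp add: zero_prod_def)
    have bdd: "bdd_above ((\<lambda>(x, r). r - c * norm (x - x\<^sub>0)) ` G)"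
      using gap[OF _ zero] by (intro bdd_aboveI2) auto
    have lower: "r - c * norm (x - x\<^sub>0) \<le> \<alpha>" if "(x, r) \<in> G" for x r
      unfolding \<alpha>_def using cSUP_upper[OF that bdd] by simp
    have upper: "\<alpha> \<le> c * norm (y + x\<^sub>0) - s" if "(y, s) \<in> G" for y s
      unfolding \<alpha>_def using gap[OF _ that] zero by (intro cSUP_least) auto
    define H where "H = {p + t *\<^sub>R (x\<^sub>0, \<alpha>) | p t. p \<in> G}"
    have GH: "G \<subseteq> H"
    proof
      fix p assume "p \<in> G"
      moreover have "p = p + 0 *\<^sub>R (x\<^sub>0, \<alpha>)" by (simp del: scaleR_Pair)
      ultimately show "p \<in> H" unfolding H_def by blast
    qed
    have "subspace H"
    proof (rule subspaceI)
      show "0 \<in> H" using GH subspace_0[OF G(1)] by blast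
    next
      fix p q assume "p \<in> H" "q \<in> H"
      then obtain p' q' s t where "p' \<in> G" "q' \<in> G" "p = p' + s *\<^sub>R (x\<^sub>0, \<alpha>)" "q = q' + t *\<^sub>R (x\<^sub>0, \<alpha>)"
        unfolding H_def by blast
      then have "p + q = (p' + q') + (s + t) *\<^sub>R (x\<^sub>0, \<alpha>)" "p' + q' \<in> G"
        using subspace_add[OF G(1)] by (simp_all add: algebra_simps)
      then show "p + q \<in> H" unfolding H_def by blast
    next
      fix a :: real and p assume "p \<in> H"
      then obtain p' s where "p' \<in> G" "p = p' + s *\<^sub>R (x\<^sub>0, \<alpha>)"
        unfolding H_def by blast
      then have "a *\<^sub>R p = a *\<^sub>R p' + (a * s) *\<^sub>R (x\<^sub>0, \<alpha>)" "a *\<^sub>R p' \<in> G"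
        using subspace_scale[OF G(1)] by (simp_all add: algebra_simps)
      then show "a *\<^sub>R p \<in> H" unfolding H_def by blast
    qed
    moreover have "r + t * \<alpha> \<le> c * norm (x + t *\<^sub>R x\<^sub>0)" if xr: "(x, r) \<in> G" for x r t
    proof -
      have scaled: "(inverse u *\<^sub>R x, inverse u * r) \<in> G" for u
        using subspace_scale[OF G(1) xr, of "inverse u"] by simp
      consider "t = 0" | "t > 0" | "t < 0" by linarith
      then show ?thesis
      proof cases
        case 1 then show ?thesis using le[OF xr] by simp
      next
        case 2
        have "t * \<alpha> \<le> t * (c * norm (inverse t *\<^sub>R x + x\<^sub>0) - inverse t * r)"
          using upper[OF scaled[of t]] 2 by (intro mult_left_mono) auto
        also have "\<dots> = c * norm (t *\<^sub>R (inverse t *\<^sub>R x + x\<^sub>0)) - r"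
          using 2 by (simp add: algebra_simps del: scaleR_add_right scaleR_right_distrib)
        finally show ?thesis using 2 by (simp add: scaleR_right_distrib)
      next
        case 3
        define u where "u = - t"
        have u: "u > 0" using 3 by (simp add: u_def)
        have "u * (inverse u * r - c * norm (inverse u *\<^sub>R x - x\<^sub>0)) \<le> u * \<alpha>"
          using lower[OF scaled[of u]] u by (intro mult_left_mono) auto
        moreover have "u * (inverse u * r - c * norm (inverse u *\<^sub>R x - x\<^sub>0)) = r - c * norm (u *\<^sub>R (inverse u *\<^sub>R x - x\<^sub>0))"
          using u by (simp add: algebra_simps del: scaleR_diff_right scaleR_right_diff_distrib)
        ultimately have "r - c * norm (x - u *\<^sub>R x\<^sub>0) \<le> u * \<alpha>" using u by (simp add: scaleR_right_diff_distrib)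
        then show ?thesis by (simp add: u_def)
      qed
    qed
    then have "\<forall>(x, r)\<in>H. r \<le> c * norm x" unfolding H_def by auto
    ultimately have "H \<in> \<A>" using G GH by (auto simp: \<A>_def)
    then have "H = G" using max GH by blast
    moreover have "(x\<^sub>0, \<alpha>) \<in> H" unfolding H_def
      using zero by (intro CollectI exI[of _ "(0,0)"] exI[of _ 1]) auto
    ultimately show False using not by blast
  qed
  define g where "g x = (THE r. (x, r) \<in> G)" for x
  have g_in: "(x, g x) \<in> G" for x
    unfolding g_def using ex[of x] uniq by (metis theI)
  have g: "g x = r" if "(x, r) \<in> G" for x r using uniq[OF g_in that] .
  have bl: "bounded_linear g"
  proof (rule bounded_linear_intro)
    show "g (x + y) = g x + g y" for x y using g subspace_add[OF G(1) g_in g_in] by simp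
    show "g (t *\<^sub>R x) = t *\<^sub>R g x" for t x using g subspace_scale[OF G(1) g_in] by simp
    show "norm (g x) \<le> norm x * c" for x
      using le[OF g_in, of x] le[of "- x" "- g x"] subspace_neg[OF G(1) g_in[of x]] by (simp add: mult.commute)
  qed
  show ?thesis
  proof (intro exI[of _ "Blinfun g"] conjI)
    show "\<forall>(x, r)\<in>G\<^sub>0. blinfun_apply (Blinfun g) x = r"
      using g G(2) by (auto simp: bounded_linear_Blinfun_apply[OF bl])
    show "norm (Blinfun g) \<le> c"
      using c le[OF g_in] le subspace_neg[OF G(1) g_in]
      by (intro norm_blinfun_bound) (fastforce simp: bounded_linear_Blinfun_apply[OF bl] abs_le_iff)+
  qed
qed

lemma hahn_banach_extension:
  fixes N :: "'a::real_normed_vector set" and g :: "'a \<Rightarrow> real"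
  assumes N: "subspace N"
    and add: "\<And>x y. x \<in> N \<Longrightarrow> y \<in> N \<Longrightarrow> g (x + y) = g x + g y"
    and scale: "\<And>t x. x \<in> N \<Longrightarrow> g (t *\<^sub>R x) = t * g x"
    and le: "\<And>x. x \<in> N \<Longrightarrow> g x \<le> c * norm x" and c: "0 \<le> c"
  obtains f :: "'a \<Rightarrow>\<^sub>L real" where "\<And>x. x \<in> N \<Longrightarrow> blinfun_apply f x = g x" "norm f \<le> c"
proof -
  have "subspace ((\<lambda>x. (x, g x)) ` N)"
    using N add scale scale[of 0 0] unfolding subspace_def 
    by (auto simp: image_iff zero_prod_def)
  from hahn_banach_graph[OF this _ c] le show ?thesis
    by (auto intro: that)
qed

lemma norming_functional:
  fixes x :: "'a::real_normed_vector"
  obtains f :: "'a \<Rightarrow>\<^sub>L real" where "blinfun_apply f x = norm x" "norm f \<le> 1"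
proof -
  have "\<exists>f :: 'a \<Rightarrow>\<^sub>L real. (\<forall>(y, r)\<in>range (\<lambda>t. (t *\<^sub>R x, t * norm x)). blinfun_apply f y = r) \<and> norm f \<le> 1"
  proof (rule hahn_banach_graph)
    show "subspace (range (\<lambda>t. (t *\<^sub>R x, t * norm x)))"
      by (rule linear_subspace_image[OF _ subspace_UNIV]) (auto intro!: linearI simp: algebra_simps)
    show "r \<le> 1 * norm y" if "(y, r) \<in> range (\<lambda>t. (t *\<^sub>R x, t * norm x))" for y r
      using that by (auto intro!: mult_right_mono)
  qed simp
  then show ?thesis by (metis (mono_tags, lifting) case_prodD rangeI scaleR_one mult_1 that)
qed

text \<open>On the span of \<open>S\<close> and \<open>x\<close>, the functional that sends \<open>y + t *\<^sub>R x\<close> to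
  \<open>t\<close> is bounded by the inverse of the distance of \<open>x\<close> from \<open>S\<close>.\<close>

lemma functional_vanishing_on_subspace:
  fixes S :: "'a::real_normed_vector set"
  assumes S: "subspace S" "closed S" and x: "x \<notin> S"
  shows "\<exists>f :: 'a \<Rightarrow>\<^sub>L real. (\<forall>y\<in>S. blinfun_apply f y = 0) \<and> blinfun_apply f x = 1"
proof -
  obtain d where d: "d > 0" "\<And>y. y \<in> S \<Longrightarrow> d \<le> norm (x - y)"
  proof -
    obtain d where "d > 0" "ball x d \<subseteq> - S"
      using S(2) x open_contains_ball[of "- S"] by blast
    then show ?thesis by (intro that[of d]) (force simp: dist_norm)+
  qed
  define G where "G = (\<lambda>(y, t). (y + t *\<^sub>R x, t)) ` (S \<times> (UNIV :: real set))"
  have "\<exists>f :: 'a \<Rightarrow>\<^sub>L real. (\<forall>(y, r)\<in>G. blinfun_apply f y = r) \<and> norm f \<le> 1 / d"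
  proof (rule hahn_banach_graph)
    show "subspace G" unfolding G_def
      by (rule linear_subspace_image[OF _ subspace_Times[OF S(1) subspace_UNIV]])
        (auto intro!: linearI simp: algebra_simps)
    fix z t assume "(z, t) \<in> G"
    then obtain y where y: "y \<in> S" "z = y + t *\<^sub>R x" by (auto simp: G_def)
    show "t \<le> 1 / d * norm z"
    proof (cases "t > 0")
      case True
      have "d \<le> norm (x - (- inverse t) *\<^sub>R y)" using d(2) subspace_scale[OF S(1) y(1)] by blast
      then have "t * d \<le> t * norm (x - (- inverse t) *\<^sub>R y)" using True by simp
      also have "\<dots> = norm (t *\<^sub>R (x - (- inverse t) *\<^sub>R y))" using True by simp
      also have "t *\<^sub>R (x - (- inverse t) *\<^sub>R y) = z" using True y by (simp add: algebra_simps)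
      finally show ?thesis using d(1) by (simp add: field_simps)
    next
      case False then show ?thesis using d(1) by (smt (verit) divide_nonneg_pos mult_nonneg_nonneg norm_ge_zero)
    qed
  qed (use d in simp)
  then obtain f :: "'a \<Rightarrow>\<^sub>L real" where f: "\<And>y r. (y, r) \<in> G \<Longrightarrow> blinfun_apply f y = r" by fast
  show ?thesis
  proof (intro exI[of _ f] conjI ballI)
    show "blinfun_apply f y = 0" if "y \<in> S" for y
      using that by (intro f) (force simp: G_def image_iff)
    show "blinfun_apply f x = 1"
      using subspace_0[OF S(1)] by (intro f) (force simp: G_def image_iff)
  qed
qed

text \<open>By Baire's theorem, one of the closed sets on which all members of the family are bounded by
  a fixed integer contains a ball.\<close>

lemma uniform_boundedness:
  fixes F :: "('a::banach \<Rightarrow>\<^sub>L real) set"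
  assumes pt: "\<And>x. \<exists>B. \<forall>f\<in>F. \<bar>blinfun_apply f x\<bar> \<le> B"
  shows "bounded F"
proof -
  define A where "A k = {x. \<forall>f\<in>F. \<bar>blinfun_apply f x\<bar> \<le> real k}" for k
  have cl: "closed (A k)" for k
  proof -
    have "A k = (\<Inter>f\<in>F. {x. \<bar>blinfun_apply f x\<bar> \<le> real k})" by (auto simp: A_def)
    then show ?thesis by (auto intro!: closed_INT closed_Collect_le continuous_intros)
  qed
  have "x \<in> \<Union>(range A)" for x
  proof -
    obtain B where "\<forall>f\<in>F. \<bar>blinfun_apply f x\<bar> \<le> B" using pt by blast
    moreover obtain k where "B \<le> real k" using real_arch_simple by blast
    ultimately have "x \<in> A k" unfolding A_def by force
    then show ?thesis by blast
  qed
  then have un: "\<Union>(range A) = UNIV" by blast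
  have "\<exists>k. interior (A k) \<noteq> {}"
  proof (rule ccontr)
    assume "\<nexists>k. interior (A k) \<noteq> {}"
    then have "euclidean interior_of \<Union>(range A) = {}"
      by (intro Baire_category_alt)
        (auto simp: cl completely_metrizable_space_euclidean)
    then show False by (simp add: un)
  qed
  then obtain k x e where e: "e > 0" "cball x e \<subseteq> A k"
    by (metis all_not_in_conv mem_interior_cball)
  show ?thesis
    unfolding bounded_iff
  proof (intro exI[of _ "2 * (real k + 1) / e"] ballI)
    fix f assume f: "f \<in> F"
    show "norm f \<le> 2 * (real k + 1) / e"
    proof (rule norm_blinfun_bound)
      fix y :: 'a
      show "norm (blinfun_apply f y) \<le> 2 * (real k + 1) / e * norm y"
      proof (cases "y = 0")
        case False
        define z where "z = (e / norm y) *\<^sub>R y"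
        have "norm z = e" using e False by (simp add: z_def)
        then have "x + z \<in> A k" "x \<in> A k" using e by (auto simp: dist_norm)
        then have "\<bar>blinfun_apply f (x + z)\<bar> \<le> k" "\<bar>blinfun_apply f x\<bar> \<le> k" using f by (auto simp: A_def)
        then have "\<bar>blinfun_apply f z\<bar> \<le> 2 * (real k + 1)" by (simp add: blinfun.add_right)
        then have "e / norm y * \<bar>blinfun_apply f y\<bar> \<le> 2 * (real k + 1)"
          using e by (simp add: z_def blinfun.scaleR_right abs_mult)
        then show ?thesis using e False by (simp add: field_simps)
      qed simp
    qed (use e in simp)
  qed
qed

section \<open>Weak and weak* convergence\<close>

lemma limitin_pullback_pointwise:
  fixes e :: "'a \<Rightarrow> 'i \<Rightarrow> real"
  shows "limitin (pullback_topology UNIV e euclidean) f l F \<longleftrightarrow> (\<forall>i. ((\<lambda>n. e (f n) i) \<longlongrightarrow> e l i) F)"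
proof -
  have "limitin (pullback_topology UNIV e euclidean) f l F \<longleftrightarrow> limitin euclidean (e \<circ> f) (e l) F"
    unfolding limitin_def openin_pullback_topology topspace_pullback_topology by auto
  also have "\<dots> \<longleftrightarrow> (\<forall>i. ((\<lambda>n. e (f n) i) \<longlongrightarrow> e l i) F)"
    unfolding euclidean_product_topology[symmetric] limitin_componentwise by simp
  finally show ?thesis .
qed

lemma limitin_weak_topology:
  "limitin weak_topology f l F \<longleftrightarrow> (\<forall>\<phi> :: 'a::real_normed_vector \<Rightarrow>\<^sub>L real. ((\<lambda>n. blinfun_apply \<phi> (f n)) \<longlongrightarrow> blinfun_apply \<phi> l) F)"
  unfolding weak_topology_def limitin_pullback_pointwise ..

lemma limitin_weak_star_topology:
  fixes f :: "'i \<Rightarrow> ('a::real_normed_vector \<Rightarrow>\<^sub>L real)"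
  shows "limitin weak_star_topology f l F \<longleftrightarrow> (\<forall>x. ((\<lambda>n. blinfun_apply (f n) x) \<longlongrightarrow> blinfun_apply l x) F)"
  unfolding weak_star_topology_def strong_operator_topology_def limitin_pullback_pointwise ..

lemma topspace_weak_topology [simp]: "topspace weak_topology = UNIV"
  by (simp add: weak_topology_def topspace_pullback_topology)

lemma continuous_map_weak_topology:
  fixes \<phi> :: "'a::real_normed_vector \<Rightarrow>\<^sub>L real"
  shows "continuous_map weak_topology euclidean (blinfun_apply \<phi>)"
proof -
  have "continuous_map weak_topology euclidean ((\<lambda>g. g \<phi>) \<circ> (\<lambda>x f. blinfun_apply f x))"
    unfolding weak_topology_def by (rule continuous_map_pullback) (simp add: continuous_map_iff_continuous2)
  then show ?thesis by (simp add: comp_def)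
qed

lemma canonical_embedding_apply [simp]: "blinfun_apply (canonical_embedding x) f = blinfun_apply f x"
  by (simp add: canonical_embedding.rep_eq)

lemma grothendieck_space_converges:
  fixes f :: "nat \<Rightarrow> ('a::banach \<Rightarrow>\<^sub>L real)"
    and \<phi> :: "('a \<Rightarrow>\<^sub>L real) \<Rightarrow>\<^sub>L real"
  assumes "grothendieck_space TYPE('a)"
    and lim: "\<And>x. (\<lambda>n. blinfun_apply (f n) x) \<longlonglongrightarrow> blinfun_apply l x"
  shows "(\<lambda>n. blinfun_apply \<phi> (f n)) \<longlonglongrightarrow> blinfun_apply \<phi> l"
proof -
  have "limitin weak_star_topology f l sequentially" using lim by (simp add: limitin_weak_star_topology)
  then obtain m where m: "\<And>\<phi> :: ('a \<Rightarrow>\<^sub>L real) \<Rightarrow>\<^sub>L real. (\<lambda>n. blinfun_apply \<phi> (f n)) \<longlonglongrightarrow> blinfun_apply \<phi> m"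
    using assms(1) unfolding grothendieck_space_def limitin_weak_topology by blast
  have "m = l"
  proof (rule blinfun_eqI)
    fix x show "blinfun_apply m x = blinfun_apply l x"
      using LIMSEQ_unique[OF _ lim[of x]] m[of "canonical_embedding x"] by simp
  qed
  with m show ?thesis by simp
qed

lemma grothendieck_spaceI:
  assumes "\<And>(f :: nat \<Rightarrow> ('a::banach \<Rightarrow>\<^sub>L real)) l (\<phi> :: ('a \<Rightarrow>\<^sub>L real) \<Rightarrow>\<^sub>L real). (\<And>x. (\<lambda>n. blinfun_apply (f n) x) \<longlonglongrightarrow> blinfun_apply l x)
    \<Longrightarrow> (\<lambda>n. blinfun_apply \<phi> (f n)) \<longlonglongrightarrow> blinfun_apply \<phi> l"
  shows "grothendieck_space TYPE('a)"
  unfolding grothendieck_space_def limitin_weak_topology limitin_weak_star_topology using assms by blast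

text \<open>Weak compactness enters the proof only in this form: closed conditions on the values of
  functionals that can be met finitely many at a time in \<open>K\<close> can be met
  simultaneously by a point of its weak closure.\<close>

lemma relatively_weakly_compact_fip:
  fixes K :: "'a::real_normed_vector set" and \<phi> :: "'i \<Rightarrow> ('a \<Rightarrow>\<^sub>L real)"
  assumes K: "relatively_weakly_compact K"
    and S: "\<And>i. i \<in> I \<Longrightarrow> closed (S i)"
    and fin: "\<And>J. finite J \<Longrightarrow> J \<subseteq> I \<Longrightarrow> \<exists>k\<in>K. \<forall>i\<in>J. blinfun_apply (\<phi> i) k \<in> S i"
  obtains g where "\<And>i. i \<in> I \<Longrightarrow> blinfun_apply (\<phi> i) g \<in> S i"
proof -
  let ?C = "\<lambda>i. {x. blinfun_apply (\<phi> i) x \<in> S i}"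
  let ?K = "weak_topology closure_of K"
  have cl: "\<forall>C\<in>?C ` I. closedin weak_topology C"
    using closedin_continuous_map_preimage[OF continuous_map_weak_topology] S by fastforce
  have "?K \<inter> \<Inter>\<F> \<noteq> {}" if F: "finite \<F>" "\<F> \<subseteq> ?C ` I" for \<F>
  proof -
    obtain J where J: "finite J" "J \<subseteq> I" "\<F> = ?C ` J" using finite_subset_image[OF F] by blast
    obtain k where "k \<in> K" "\<forall>i\<in>J. blinfun_apply (\<phi> i) k \<in> S i" using fin[OF J(1,2)] by blast
    moreover have "K \<subseteq> ?K" by (rule closure_of_subset) simp
    ultimately show ?thesis using J by blast
  qed
  then have "?K \<inter> \<Inter>(?C ` I) \<noteq> {}"
    using K cl unfolding relatively_weakly_compact_def compactin_fip by blast
  then show ?thesis using that by blast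
qed

text \<open>A weak cluster point of a weak* convergent sequence must be the weak* limit.\<close>

lemma weak_limit_if_relatively_weakly_compact:
  fixes f :: "nat \<Rightarrow> ('a::real_normed_vector \<Rightarrow>\<^sub>L real)"
    and \<phi> :: "('a \<Rightarrow>\<^sub>L real) \<Rightarrow>\<^sub>L real"
  assumes K: "relatively_weakly_compact (range f)"
    and lim: "\<And>x. (\<lambda>n. blinfun_apply (f n) x) \<longlonglongrightarrow> blinfun_apply l x"
  shows "(\<lambda>n. blinfun_apply \<phi> (f n)) \<longlonglongrightarrow> blinfun_apply \<phi> l"
proof (rule ccontr)
  assume "\<not> ?thesis"
  then obtain e where e: "e > 0" "\<And>N. \<exists>n\<ge>N. e \<le> \<bar>blinfun_apply \<phi> (f n) - blinfun_apply \<phi> l\<bar>"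
    unfolding LIMSEQ_iff real_norm_def by (metis not_less)
  \<comment> \<open>\<open>None\<close> keeps \<open>\<phi>\<close> away from its value at \<open>l\<close>; the other conditions force a
    common solution to coincide with \<open>l\<close>.\<close>
  define S where "S i = (case i of None \<Rightarrow> {r. e \<le> \<bar>r - blinfun_apply \<phi> l\<bar>}
    | Some (x, m) \<Rightarrow> {r. \<bar>r - blinfun_apply l x\<bar> \<le> 1 / real (Suc m)})" for i :: "('a \<times> nat) option"
  define \<psi> where "\<psi> i = (case i of None \<Rightarrow> \<phi> | Some (x, m) \<Rightarrow> canonical_embedding x)" for i :: "('a \<times> nat) option"
  have "\<exists>g. \<forall>i. blinfun_apply (\<psi> i) g \<in> S i"
  proof (rule relatively_weakly_compact_fip[OF K, where I = UNIV and S = S and \<phi> = \<psi>])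
    show "closed (S i)" for i unfolding S_def
      by (auto split: option.split intro!: closed_Collect_le continuous_intros)
    show "\<exists>k\<in>range f. \<forall>i\<in>J. blinfun_apply (\<psi> i) k \<in> S i" if "finite J" for J
    proof -
      have "eventually (\<lambda>n. i = None \<or> blinfun_apply (\<psi> i) (f n) \<in> S i) sequentially" for i
      proof (cases i)
        case (Some p)
        obtain x m where p: "p = (x, m)" by (cases p)
        have "eventually (\<lambda>n. dist (blinfun_apply (f n) x) (blinfun_apply l x) < 1 / real (Suc m)) sequentially"
          using lim[of x] by (rule tendstoD) simp
        then show ?thesis by eventually_elim (auto simp: Some p \<psi>_def S_def dist_real_def)
      qed simp
      then have "eventually (\<lambda>n. \<forall>i\<in>J. i = None \<or> blinfun_apply (\<psi> i) (f n) \<in> S i) sequentially"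
        using that by (simp add: eventually_ball_finite)
      then obtain N where N: "\<And>n. n \<ge> N \<Longrightarrow> \<forall>i\<in>J. i = None \<or> blinfun_apply (\<psi> i) (f n) \<in> S i"
        unfolding eventually_sequentially by blast
      obtain n where n: "n \<ge> N" "e \<le> \<bar>blinfun_apply \<phi> (f n) - blinfun_apply \<phi> l\<bar>" using e(2) by blast
      then have "blinfun_apply (\<psi> None) (f n) \<in> S None" by (simp add: \<psi>_def S_def)
      then have "blinfun_apply (\<psi> i) (f n) \<in> S i" if "i \<in> J" for i
        using N[OF n(1)] that by (cases "i = None") auto
      then show ?thesis by (intro bexI[of _ "f n"]) auto
    qed
  qed blast
  then obtain g where g: "\<And>i. blinfun_apply (\<psi> i) g \<in> S i" by blast
  have "g = l"
  proof (rule blinfun_eqI)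
    fix x
    have "\<bar>blinfun_apply g x - blinfun_apply l x\<bar> \<le> 1 / real (Suc m)" for m
      using g[of "Some (x, m)"] by (simp add: \<psi>_def S_def)
    moreover have "(\<lambda>m. 1 / real (Suc m)) \<longlonglongrightarrow> 0" using LIMSEQ_inverse_real_of_nat by (simp add: inverse_eq_divide)
    ultimately have "\<bar>blinfun_apply g x - blinfun_apply l x\<bar> \<le> 0"
      by (intro LIMSEQ_le_const) auto
    then show "blinfun_apply g x = blinfun_apply l x" by simp
  qed
  then show False using g[of None] e(1) by (simp add: \<psi>_def S_def)
qed

section \<open>Translation invariant means\<close>

text \<open>The functional is total, but its values on unbounded functions are arbitrary.  The upper
  bound, applied to \<open>h\<close> and \<open>- h\<close>, also gives positivity and the normalisation
  \<open>mean_const\<close>.\<close>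

definition is_mean :: "(('a \<Rightarrow> real) \<Rightarrow> real) \<Rightarrow> bool" where
  "is_mean M \<longleftrightarrow>
    (\<forall>h k. bounded (range h) \<longrightarrow> bounded (range k) \<longrightarrow> M (\<lambda>x. h x + k x) = M h + M k) \<and>
    (\<forall>c h. bounded (range h) \<longrightarrow> M (\<lambda>x. c * h x) = c * M h) \<and>
    (\<forall>h C. bounded (range h) \<longrightarrow> (\<forall>x. h x \<le> C) \<longrightarrow> M h \<le> C)"

lemma bounded_range_real: "bounded (range h) \<longleftrightarrow> (\<exists>C. \<forall>x. \<bar>h x :: real\<bar> \<le> C)"
  by (auto simp: bounded_iff)

lemma is_meanD:
  assumes "is_mean M"
  shows mean_add: "bounded (range h) \<Longrightarrow> bounded (range k) \<Longrightarrow> M (\<lambda>x. h x + k x) = M h + M k"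
    and mean_scale: "bounded (range h) \<Longrightarrow> M (\<lambda>x. c * h x) = c * M h"
    and mean_upper: "bounded (range h) \<Longrightarrow> (\<And>x. h x \<le> C) \<Longrightarrow> M h \<le> C"
  using assms unfolding is_mean_def by blast+

lemma mean_lower:
  assumes "is_mean M" "bounded (range h)" "\<And>x. C \<le> h x"
  shows "C \<le> M h"
  using mean_upper[OF assms(1), of "\<lambda>x. -1 * h x" "- C"] mean_scale[OF assms(1,2), of "-1"] assms(2,3)
  by (auto simp: bounded_range_real)

lemma mean_abs_le:
  assumes "is_mean M" "\<And>x. \<bar>h x\<bar> \<le> C"
  shows "\<bar>M h\<bar> \<le> C"
proof -
  have "bounded (range h)" using assms(2) by (auto simp: bounded_range_real)
  moreover have "h x \<le> C" "- C \<le> h x" for x using assms(2)[of x] by auto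
  ultimately show ?thesis using mean_upper[OF assms(1), of h C] mean_lower[OF assms(1), of h "- C"]
    by (simp add: abs_le_iff)
qed

lemma mean_const: "is_mean M \<Longrightarrow> M (\<lambda>_. c) = c"
  using mean_upper[of M "\<lambda>_. c" c] mean_lower[of M "\<lambda>_. c" c] by (simp add: antisym)

text \<open>Averaging over the first \<open>n\<close> multiples of \<open>w\<close> changes a mean into one that is
  invariant under \<open>w\<close> up to a telescoping error of order \<open>1 / n\<close>.  This averaging commutes with all
  translations, so the invariance already obtained for \<open>F\<close> survives.\<close>

lemma almost_invariant_mean:
  fixes F :: "'a::comm_monoid_add set"
  assumes "finite F" and n: "0 < n"
  shows "\<exists>M. is_mean M \<and> (\<forall>z\<in>F. \<forall>h C. (\<forall>x. \<bar>h x\<bar> \<le> C) \<longrightarrow> \<bar>M (\<lambda>x. h (x + z)) - M h\<bar> \<le> 2 * C / real n)"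
  using assms(1)
proof (induction F)
  case empty
  have "is_mean (\<lambda>h :: 'a \<Rightarrow> real. h 0)" by (auto simp: is_mean_def)
  then show ?case by blast
next
  case (insert w F)
  then obtain M where M: "is_mean M"
    and inv: "\<And>z h C. z \<in> F \<Longrightarrow> (\<And>x. \<bar>h x\<bar> \<le> C) \<Longrightarrow> \<bar>M (\<lambda>x. h (x + z)) - M h\<bar> \<le> 2 * C / real n"
    by blast
  define mult where "mult k = ((\<lambda>y. y + w) ^^ k) 0" for k :: nat
  have mult_Suc: "mult (Suc k) = mult k + w" and mult_0: "mult 0 = 0" for k by (auto simp: mult_def)
  define A where "A h = (\<lambda>x. (\<Sum>k<n. h (x + mult k)) / real n)" for h :: "'a \<Rightarrow> real"
  have A_upper: "A h x \<le> C" if "\<And>x. h x \<le> C" for h x C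
  proof -
    have "(\<Sum>k<n. h (x + mult k)) \<le> real (card {..<n}) * C" using that by (intro sum_bounded_above) auto
    then show ?thesis using n by (simp add: A_def divide_le_eq mult.commute)
  qed
  have A_add: "A (\<lambda>x. h x + k x) = (\<lambda>x. A h x + A k x)" for h k
    by (auto simp: A_def sum.distrib add_divide_distrib)
  have A_scale: "A (\<lambda>x. c * h x) = (\<lambda>x. c * A h x)" for h c
    by (auto simp: A_def sum_distrib_left)
  have A_abs: "\<bar>A h x\<bar> \<le> C" if "\<And>x. \<bar>h x\<bar> \<le> C" for h x C
  proof -
    have "h x \<le> C" "-1 * h x \<le> C" for x using that[of x] by auto
    then have "A h x \<le> C" "A (\<lambda>x. -1 * h x) x \<le> C"
      using A_upper[of h C x] A_upper[of "\<lambda>x. -1 * h x" C x] by blast+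
    then show ?thesis unfolding A_scale by simp
  qed
  have A_bounded: "bounded (range (A h))" if "bounded (range h)" for h
    using that A_abs[of h] unfolding bounded_range_real by metis
  show ?case
  proof (intro exI[of _ "\<lambda>h. M (A h)"] conjI ballI allI impI)
    show "is_mean (\<lambda>h. M (A h))"
      unfolding is_mean_def
    proof (intro conjI allI impI)
      show "M (A (\<lambda>x. h x + k x)) = M (A h) + M (A k)" if "bounded (range h)" "bounded (range k)" for h k
        unfolding A_add using that by (intro mean_add[OF M] A_bounded)
      show "M (A (\<lambda>x. c * h x)) = c * M (A h)" if "bounded (range h)" for h c
        unfolding A_scale using that by (intro mean_scale[OF M] A_bounded)
      show "M (A h) \<le> C" if "bounded (range h)" "\<forall>x. h x \<le> C" for h C
        using that A_upper[of h C] by (intro mean_upper[OF M] A_bounded) auto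
    qed
    fix z C and h :: "'a \<Rightarrow> real" assume z: "z \<in> insert w F" and C: "\<forall>x. \<bar>h x\<bar> \<le> C"
    show "\<bar>M (A (\<lambda>x. h (x + z))) - M (A h)\<bar> \<le> 2 * C / real n"
    proof (cases "z \<in> F")
      case True
      have "A (\<lambda>x. h (x + z)) = (\<lambda>x. A h (x + z))" by (simp add: A_def ac_simps)
      then show ?thesis using inv[OF True, of "A h" C] A_abs[of h C] C by simp
    next
      case False
      then have "z = w" using z by simp
      \<comment> \<open>The sum over the orbit of \<open>w\<close> telescopes.\<close>
      have tel: "A (\<lambda>x. h (x + w)) x = A h x + (h (x + mult n) - h x) / real n" for x
      proof -
        have "(\<Sum>k<n. h (x + mult k + w)) - (\<Sum>k<n. h (x + mult k)) = h (x + mult n) - h x"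
          using sum_lessThan_telescope[of "\<lambda>k. h (x + mult k)" n]
          by (simp add: sum_subtractf mult_Suc mult_0 add.assoc)
        then show ?thesis by (simp add: A_def field_simps add_divide_distrib[symmetric])
      qed
      have small: "\<bar>(h (x + mult n) - h x) / real n\<bar> \<le> 2 * C / real n" for x
      proof -
        have "\<bar>h (x + mult n) - h x\<bar> \<le> 2 * C" using C[rule_format, of "x + mult n"] C[rule_format, of x] by linarith
        then show ?thesis by (simp add: divide_right_mono)
      qed
      have "M (\<lambda>x. A h x + (h (x + mult n) - h x) / real n) = M (A h) + M (\<lambda>x. (h (x + mult n) - h x) / real n)"
        using small C A_abs[of h C] by (intro mean_add[OF M]) (unfold bounded_range_real, blast+)
      moreover have "\<bar>M (\<lambda>x. (h (x + mult n) - h x) / real n)\<bar> \<le> 2 * C / real n"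
        by (rule mean_abs_le[OF M small])
      ultimately show ?thesis unfolding \<open>z = w\<close> tel[abs_def] by simp
    qed
  qed
qed

lemma closed_Collect_imp_const: "(P \<Longrightarrow> closed {x. Q x}) \<Longrightarrow> closed {x. P \<longrightarrow> Q x}"
  by (cases P) auto

text \<open>The almost invariant means lie in a product of compact intervals, and the invariance
  conditions are closed, so Tychonoff's theorem yields a mean that satisfies all of them.\<close>

theorem invariant_mean_exists:
  obtains M :: "('a::comm_monoid_add \<Rightarrow> real) \<Rightarrow> real"
  where "is_mean M" "\<And>h z. bounded (range h) \<Longrightarrow> M (\<lambda>x. h (x + z)) = M h"
proof -
  define R where "R h = (if bounded (range h) then {- (SUP x. \<bar>h x\<bar>)..(SUP x. \<bar>h x\<bar>)} else {0})" for h :: "'a \<Rightarrow> real"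
  have bdd: "bounded (range h) \<Longrightarrow> \<bar>h x\<bar> \<le> (SUP x. \<bar>h x\<bar>)" for h :: "'a \<Rightarrow> real" and x
    by (rule cSUP_upper) (auto simp: bounded_range_real bdd_above_def)
  have "compactin (product_topology (\<lambda>_. euclidean) UNIV) (PiE UNIV R)"
    by (auto simp: compactin_PiE R_def)
  then have cpt: "compact (PiE UNIV R)" by (simp add: euclidean_product_topology)
  have clm: "closed {M :: ('a \<Rightarrow> real) \<Rightarrow> real. is_mean M}"
    unfolding is_mean_def
    by (intro closed_Collect_conj closed_Collect_all closed_Collect_imp_const closed_Collect_eq closed_Collect_le
        continuous_intros continuous_on_product_coordinates)
  define D where "D = (\<lambda>(z, n). {M :: ('a \<Rightarrow> real) \<Rightarrow> real. \<forall>h C. (\<forall>x. \<bar>h x\<bar> \<le> C) \<longrightarrow>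
    \<bar>M (\<lambda>x. h (x + z)) - M h\<bar> \<le> 2 * C / real (Suc n)})"
  have clD: "closed (D i)" for i
    unfolding D_def by (cases i)
     (auto intro!: closed_Collect_conj closed_Collect_all closed_Collect_imp_const closed_Collect_eq closed_Collect_le
        continuous_intros continuous_on_product_coordinates)
  have "(PiE UNIV R \<inter> {M. is_mean M}) \<inter> (\<Inter>i\<in>UNIV. D i) \<noteq> {}"
  proof (rule compact_imp_fip_image[OF compact_Int_closed[OF cpt clm] clD])
    fix J :: "('a \<times> nat) set" assume J: "finite J"
    obtain N where N: "\<And>z n. (z, n) \<in> J \<Longrightarrow> n \<le> N"
      using finite_nat_set_iff_bounded_le[of "snd ` J"] J by force
    obtain M where M: "is_mean M"
      and inv: "\<And>z h C. z \<in> fst ` J \<Longrightarrow> (\<forall>x. \<bar>h x\<bar> \<le> C) \<Longrightarrow> \<bar>M (\<lambda>x. h (x + z)) - M h\<bar> \<le> 2 * C / real (Suc N)"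
      using almost_invariant_mean[of "fst ` J" "Suc N"] J by blast
    \<comment> \<open>Setting the values on unbounded functions to 0 puts \<open>M\<close> into the compact product.\<close>
    define M' where "M' h = (if bounded (range h) then M h else 0)" for h
    have "is_mean M'"
      unfolding is_mean_def
    proof (intro conjI allI impI)
      fix h k :: "'a \<Rightarrow> real" assume hk: "bounded (range h)" "bounded (range k)"
      obtain C D where "\<forall>x. \<bar>h x\<bar> \<le> C" "\<forall>x. \<bar>k x\<bar> \<le> D" using hk unfolding bounded_range_real by blast
      then have "\<bar>h x + k x\<bar> \<le> C + D" for x by (metis abs_triangle_ineq add_mono order_trans)
      then have "bounded (range (\<lambda>x. h x + k x))" unfolding bounded_range_real by blast
      then show "M' (\<lambda>x. h x + k x) = M' h + M' k" using mean_add[OF M hk] hk by (simp add: M'_def)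
    next
      fix c and h :: "'a \<Rightarrow> real" assume h: "bounded (range h)"
      then obtain C where "\<forall>x. \<bar>h x\<bar> \<le> C" unfolding bounded_range_real by blast
      then have "\<bar>c * h x\<bar> \<le> \<bar>c\<bar> * C" for x by (simp add: abs_mult mult_left_mono)
      then have "bounded (range (\<lambda>x. c * h x))" unfolding bounded_range_real by blast
      then show "M' (\<lambda>x. c * h x) = c * M' h" using mean_scale[OF M h] h by (simp add: M'_def)
    next
      show "M' h \<le> C" if "bounded (range h)" "\<forall>x. h x \<le> C" for h C
        using mean_upper[OF M that(1)] that by (simp add: M'_def)
    qed
    moreover have "M' \<in> PiE UNIV R"
    proof (rule PiE_I)
      fix h
      show "M' h \<in> R h"
        using mean_abs_le[OF M, of h "SUP x. \<bar>h x\<bar>"] bdd[of h] by (auto simp: M'_def R_def abs_le_iff)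
    qed simp
    moreover have "M' \<in> D i" if "i \<in> J" for i
    proof -
      obtain z n where i: "i = (z, n)" by (cases i)
      have "\<bar>M' (\<lambda>x. h (x + z)) - M' h\<bar> \<le> 2 * C / real (Suc n)" if C: "\<forall>x. \<bar>h x\<bar> \<le> C" for h C
      proof -
        have "bounded (range h)" "bounded (range (\<lambda>x. h (x + z)))" using C unfolding bounded_range_real by blast+
        then have "\<bar>M' (\<lambda>x. h (x + z)) - M' h\<bar> \<le> 2 * C / real (Suc N)"
          using inv[OF _ C] \<open>i \<in> J\<close> i by (force simp: M'_def)
        also have "\<dots> \<le> 2 * C / real (Suc n)"
          using N \<open>i \<in> J\<close> i order_trans[OF abs_ge_zero C[rule_format]] by (intro divide_left_mono) auto
        finally show ?thesis .
      qed
      then show ?thesis by (simp add: D_def i)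
    qed
    ultimately show "(PiE UNIV R \<inter> {M. is_mean M}) \<inter> (\<Inter>i\<in>J. D i) \<noteq> {}" by blast
  qed
  then obtain M where M: "is_mean M" "\<And>z n. M \<in> D (z, n)" by blast
  show ?thesis
  proof (rule that[OF M(1)])
    fix h :: "'a \<Rightarrow> real" and z assume "bounded (range h)"
    then obtain C where "\<forall>x. \<bar>h x\<bar> \<le> C" unfolding bounded_range_real by blast
    then have "\<bar>M (\<lambda>x. h (x + z)) - M h\<bar> \<le> 2 * C * inverse (real (Suc n))" for n
      using M(2)[of z n] by (simp add: D_def divide_inverse)
    moreover have "(\<lambda>n. 2 * C * inverse (real (Suc n))) \<longlonglongrightarrow> 2 * C * 0"
      by (intro tendsto_intros LIMSEQ_inverse_real_of_nat)
    ultimately have "\<bar>M (\<lambda>x. h (x + z)) - M h\<bar> \<le> 2 * C * 0"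
      by (intro LIMSEQ_le_const) auto
    then show "M (\<lambda>x. h (x + z)) = M h" by simp
  qed
qed

section \<open>Weakly unconditionally Cauchy series in the dual of a Grothendieck space\<close>

text \<open>An invariant mean on the natural numbers is a Banach limit; applied along a bounded sequence
  it gives an element of the bidual that plays the role of a weak* cluster point.\<close>

lemma limit_functional:
  fixes x :: "nat \<Rightarrow> 'a::real_normed_vector"
  assumes x: "\<And>k. norm (x k) \<le> 1"
  obtains \<phi> :: "('a \<Rightarrow>\<^sub>L real) \<Rightarrow>\<^sub>L real"
  where "\<And>f a. (\<lambda>k. blinfun_apply f (x k)) \<longlonglongrightarrow> a \<Longrightarrow> blinfun_apply \<phi> f = a"
    and "\<And>f c. (\<And>k. c \<le> blinfun_apply f (x k)) \<Longrightarrow> c \<le> blinfun_apply \<phi> f"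
proof -
  obtain M :: "(nat \<Rightarrow> real) \<Rightarrow> real"
    where M: "is_mean M" and inv: "\<And>h z. bounded (range h) \<Longrightarrow> M (\<lambda>k. h (k + z)) = M h"
    using invariant_mean_exists by blast
  define g where "g f = M (\<lambda>k. blinfun_apply f (x k))" for f
  have le: "\<bar>blinfun_apply f (x k)\<bar> \<le> norm f" for f :: "'a \<Rightarrow>\<^sub>L real" and k
    using norm_blinfun[of f "x k"] mult_left_mono[OF x[of k], of "norm f"] by simp
  have bdd: "bounded (range (\<lambda>k. blinfun_apply f (x k)))" for f :: "'a \<Rightarrow>\<^sub>L real"
    using le unfolding bounded_range_real by blast
  have "bounded_linear g"
  proof (rule bounded_linear_intro)
    show "g (f + h) = g f + g h" for f h
      unfolding g_def blinfun.add_left by (rule mean_add[OF M bdd bdd])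
    show "g (t *\<^sub>R f) = t *\<^sub>R g f" for t f
      using mean_scale[OF M bdd, of t f] by (simp add: g_def blinfun.scaleR_left)
    show "norm (g f) \<le> norm f * 1" for f
      using mean_abs_le[OF M le] by (simp add: g_def)
  qed
  then have app: "blinfun_apply (Blinfun g) = g" by (rule bounded_linear_Blinfun_apply)
  show ?thesis
  proof (rule that[of "Blinfun g"])
    fix c and f :: "'a \<Rightarrow>\<^sub>L real" assume "\<And>k. c \<le> blinfun_apply f (x k)"
    then show "c \<le> blinfun_apply (Blinfun g) f"
      unfolding app g_def by (intro mean_lower[OF M bdd])
  next
    fix a and f :: "'a \<Rightarrow>\<^sub>L real" assume lim: "(\<lambda>k. blinfun_apply f (x k)) \<longlonglongrightarrow> a"
    have "\<bar>g f - a\<bar> \<le> e" if "e > 0" for e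
    proof -
      obtain N where N: "\<And>k. k \<ge> N \<Longrightarrow> \<bar>blinfun_apply f (x k) - a\<bar> < e"
        using lim \<open>e > 0\<close> unfolding LIMSEQ_iff by auto
      have b: "bounded (range (\<lambda>k. blinfun_apply f (x (k + N))))"
        using le unfolding bounded_range_real by blast
      have near: "a - e \<le> blinfun_apply f (x (k + N))" "blinfun_apply f (x (k + N)) \<le> a + e" for k
        using N[of "k + N"] by auto
      have "g f = M (\<lambda>k. blinfun_apply f (x (k + N)))" unfolding g_def using inv[OF bdd] by metis
      then show ?thesis
        using mean_lower[OF M b near(1)] mean_upper[OF M b near(2)] by (simp add: abs_le_iff)
    qed
    then have "\<bar>g f - a\<bar> \<le> 0" using field_le_epsilon[of "\<bar>g f - a\<bar>" 0] by simp
    then show "blinfun_apply (Blinfun g) f = a" by (simp add: app)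
  qed
qed

lemma wuC_subseries:
  fixes f :: "nat \<Rightarrow> 'a::banach"
  assumes "wuC f" "inj r"
  shows "wuC (\<lambda>n. f (r n))"
  unfolding wuC_def
proof
  fix \<phi> :: "'a \<Rightarrow>\<^sub>L real"
  have "summable ((\<lambda>n. \<bar>blinfun_apply \<phi> (f n)\<bar>) \<circ> r)"
    using assms by (intro summable_reindex) (auto simp: wuC_def)
  then show "summable (\<lambda>n. \<bar>blinfun_apply \<phi> (f (r n))\<bar>)" by (simp add: comp_def)
qed

text \<open>Boundedness of the pointwise sum comes from uniform boundedness of the partial sums.\<close>

lemma wuC_dual_sum:
  fixes f :: "nat \<Rightarrow> ('a::banach \<Rightarrow>\<^sub>L real)"
  assumes w: "wuC f"
  obtains s :: "'a \<Rightarrow>\<^sub>L real" where "\<And>x. (\<lambda>n. blinfun_apply (f n) x) sums blinfun_apply s x"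
proof -
  have abs: "summable (\<lambda>n. \<bar>blinfun_apply (f n) x\<bar>)" for x
    using w[unfolded wuC_def, rule_format, of "canonical_embedding x"] by simp
  have summ: "summable (\<lambda>n. blinfun_apply (f n) x)" for x
    by (rule summable_rabs_cancel[OF abs])
  define S where "S N = (\<Sum>n<N. f n)" for N
  define g where "g x = (\<Sum>n. blinfun_apply (f n) x)" for x
  have S_apply: "blinfun_apply (S N) x = (\<Sum>n<N. blinfun_apply (f n) x)" for N x
    unfolding S_def by (induction N) (simp_all add: blinfun.add_left)
  have lim: "(\<lambda>N. blinfun_apply (S N) x) \<longlonglongrightarrow> g x" for x
    unfolding S_apply g_def by (rule summable_LIMSEQ[OF summ])
  have "\<exists>B. \<forall>h\<in>range S. \<bar>blinfun_apply h x\<bar> \<le> B" for x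
    using convergent_imp_Bseq[OF convergentI[OF lim[of x]]] by (auto simp: Bseq_def)
  then obtain B where B: "\<And>N. norm (S N) \<le> B" 
    using uniform_boundedness[of "range S"] by (auto simp: bounded_iff)
  have "bounded_linear g"
  proof (rule bounded_linear_intro)
    show "g (x + y) = g x + g y" for x y
      using suminf_add[OF summ summ] by (simp add: g_def blinfun.add_right)
    show "g (t *\<^sub>R x) = t *\<^sub>R g x" for t x
      using suminf_mult[OF summ] by (simp add: g_def blinfun.scaleR_right)
    show "norm (g x) \<le> norm x * B" for x
    proof (rule LIMSEQ_le_const2)
      show "(\<lambda>N. norm (blinfun_apply (S N) x)) \<longlonglongrightarrow> norm (g x)" by (intro tendsto_norm lim)
      have "norm (blinfun_apply (S N) x) \<le> norm x * B" for N
        using norm_blinfun[of "S N" x] mult_right_mono[OF B[of N], of "norm x"] by (simp add: mult.commute)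
      then show "\<exists>N. \<forall>n\<ge>N. norm (blinfun_apply (S n) x) \<le> norm x * B" by blast
    qed
  qed
  then have "blinfun_apply (Blinfun g) = g" by (rule bounded_linear_Blinfun_apply)
  then show ?thesis using that[of "Blinfun g"] summ by (simp add: g_def summable_sums)
qed

lemma sum_reindex_le:
  fixes g :: "'b \<Rightarrow> real"
  assumes "inj_on k I" "finite S" "k ` I \<subseteq> S" "\<And>n. 0 \<le> g n"
  shows "(\<Sum>i\<in>I. g (k i)) \<le> (\<Sum>n\<in>S. g n)"
proof -
  have "(\<Sum>i\<in>I. g (k i)) = sum g (k ` I)" using sum.reindex[OF assms(1), of g] by (simp add: comp_def)
  also have "\<dots> \<le> sum g S" using assms by (intro sum_mono2) auto
  finally show ?thesis .
qed

lemma summable_tail_small: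
  fixes a :: "nat \<Rightarrow> real"
  assumes "summable (\<lambda>n. \<bar>a n\<bar>)" "e > 0"
  shows "eventually (\<lambda>m. \<forall>N. (\<Sum>n\<in>{m..<N}. \<bar>a n\<bar>) \<le> e) sequentially"
proof -
  obtain K where K: "\<forall>m\<ge>K. \<forall>N. norm (\<Sum>n=m..<N. \<bar>a n\<bar>) < e" using assms unfolding summable_Cauchy by blast
  have "\<forall>N. (\<Sum>n\<in>{m..<N}. \<bar>a n\<bar>) \<le> e" if "m \<ge> K" for m
  proof
    fix N show "(\<Sum>n\<in>{m..<N}. \<bar>a n\<bar>) \<le> e"
      using K[rule_format, OF that, of N] by (auto simp: abs_less_iff intro: less_imp_le)
  qed
  then show ?thesis unfolding eventually_sequentially by blast
qed

text \<open>The gliding hump.  Along a sparse subsequence \<open>k\<close> the matrix of the values of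
  \<open>f (k i)\<close> at \<open>x (k j)\<close> is nearly \<open>a (k i)\<close> before the diagonal, at least \<open>\<delta>\<close> on
  it and nearly 0 after it, while the \<open>a (k i)\<close> have a small sum.  The weak* sum \<open>s\<close> of the
  \<open>f (k i)\<close> is then large at every \<open>x (k j)\<close>, and so is its value under a limit functional
  \<open>\<phi>\<close> of these points.  In a Grothendieck space this value would be the small sum of the
  \<open>\<phi> (f (k i)) = a (k i)\<close>.\<close>

lemma wuC_no_uniformly_large_diagonal:
  fixes f :: "nat \<Rightarrow> ('a::banach \<Rightarrow>\<^sub>L real)"
  assumes G: "grothendieck_space TYPE('a)" and w: "wuC f"
    and x: "\<And>k. norm (x k) \<le> 1"
    and lim: "\<And>n. (\<lambda>k. blinfun_apply (f n) (x k)) \<longlonglongrightarrow> a n"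
    and \<delta>: "0 < \<delta>" "\<And>n. \<delta> \<le> blinfun_apply (f n) (x n)"
  shows False
proof -
  have e: "\<delta> / 8 > 0" using \<delta>(1) by simp
  obtain \<phi>\<^sub>0 :: "('a \<Rightarrow>\<^sub>L real) \<Rightarrow>\<^sub>L real"
    where "\<And>f a. (\<lambda>k. blinfun_apply f (x k)) \<longlonglongrightarrow> a \<Longrightarrow> blinfun_apply \<phi>\<^sub>0 f = a"
    using limit_functional[of x] x by metis
  then have "blinfun_apply \<phi>\<^sub>0 (f n) = a n" for n using lim by blast
  then have a: "summable (\<lambda>n. \<bar>a n\<bar>)" using w[unfolded wuC_def, rule_format, of \<phi>\<^sub>0] by simp
  obtain k\<^sub>0 where k\<^sub>0: "\<And>N. (\<Sum>n\<in>{k\<^sub>0..<N}. \<bar>a n\<bar>) \<le> \<delta> / 8"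
    using summable_tail_small[OF a e] unfolding eventually_sequentially by blast
  \<comment> \<open>\<open>Q m m'\<close> says that \<open>m'\<close> may follow \<open>m\<close> in the sparse subsequence; it involves
    all indices up to \<open>m\<close> and all from \<open>m'\<close> on, so it only has to hold for consecutive terms.\<close>
  define Q where "Q m m' \<longleftrightarrow> (\<Sum>n\<le>m. \<bar>blinfun_apply (f n) (x m') - a n\<bar>) \<le> \<delta> / 8 \<and>
    (\<forall>N. (\<Sum>n\<in>{m'..<N}. \<bar>blinfun_apply (f n) (x m)\<bar>) \<le> \<delta> / 8)" for m m'
  have ex: "\<exists>m'. k\<^sub>0 \<le> m' \<and> (m < m' \<and> Q m m')" for m
  proof -
    have "(\<lambda>m'. \<Sum>n\<le>m. \<bar>blinfun_apply (f n) (x m') - a n\<bar>) \<longlonglongrightarrow> (\<Sum>n\<le>m. \<bar>a n - a n\<bar>)"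
      by (intro tendsto_intros lim)
    then have "eventually (\<lambda>m'. (\<Sum>n\<le>m. \<bar>blinfun_apply (f n) (x m') - a n\<bar>) < \<delta> / 8) sequentially"
      using e by (intro order_tendstoD) auto
    moreover have "summable (\<lambda>n. \<bar>blinfun_apply (f n) (x m)\<bar>)"
      using w[unfolded wuC_def, rule_format, of "canonical_embedding (x m)"] by simp
    note summable_tail_small[OF this e]
    ultimately have "eventually (\<lambda>m'. Q m m') sequentially"
      unfolding Q_def by eventually_elim auto
    then have "eventually (\<lambda>m'. k\<^sub>0 \<le> m' \<and> m < m' \<and> Q m m') sequentially"
      by (intro eventually_conj eventually_ge_at_top eventually_gt_at_top)
    then show ?thesis by (auto dest: eventually_happens)
  qed
  \<comment> \<open>Starting at \<open>k\<^sub>0\<close> makes the limits \<open>a\<close> negligible along the subsequence.\<close>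
  have "\<exists>k. \<forall>j. k\<^sub>0 \<le> k j \<and> (k j < k (Suc j) \<and> Q (k j) (k (Suc j)))"
    using ex by (intro dependent_nat_choice) auto
  then obtain k :: "nat \<Rightarrow> nat" where k\<^sub>0_le: "\<And>j. k\<^sub>0 \<le> k j" and "\<And>j. k j < k (Suc j)" and Q: "\<And>j. Q (k j) (k (Suc j))"
    by blast
  then have k: "strict_mono k" by (simp add: strict_mono_Suc_iff)
  have inj: "inj_on k I" for I by (rule strict_mono_imp_inj_on[OF k])
  have sum_a: "(\<Sum>i<J. \<bar>a (k i)\<bar>) \<le> \<delta> / 8" for J
  proof -
    have "(\<Sum>i<J. \<bar>a (k i)\<bar>) \<le> (\<Sum>n\<in>{k\<^sub>0..<k J}. \<bar>a n\<bar>)"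
      using k\<^sub>0_le k by (intro sum_reindex_le inj) (auto simp: strict_mono_less)
    then show ?thesis using k\<^sub>0[of "k J"] by linarith
  qed
  have before: "(\<Sum>i<j. \<bar>blinfun_apply (f (k i)) (x (k j)) - a (k i)\<bar>) \<le> \<delta> / 8" for j
  proof (cases j)
    case (Suc j')
    have "(\<Sum>i<j. \<bar>blinfun_apply (f (k i)) (x (k j)) - a (k i)\<bar>)
        \<le> (\<Sum>n\<le>k j'. \<bar>blinfun_apply (f n) (x (k j)) - a n\<bar>)"
      using k Suc by (intro sum_reindex_le[where g = "\<lambda>n. \<bar>blinfun_apply (f n) (x (k j)) - a n\<bar>"] inj)
        (auto simp: strict_mono_less_eq)
    then show ?thesis using Q[of j'] unfolding Q_def Suc by linarith
  qed (use e in simp)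
  have after: "(\<Sum>i\<in>{Suc j..<J}. \<bar>blinfun_apply (f (k i)) (x (k j))\<bar>) \<le> \<delta> / 8" for j J
  proof -
    have "(\<Sum>i\<in>{Suc j..<J}. \<bar>blinfun_apply (f (k i)) (x (k j))\<bar>)
        \<le> (\<Sum>n\<in>{k (Suc j)..<k J}. \<bar>blinfun_apply (f n) (x (k j))\<bar>)"
      using k by (intro sum_reindex_le[where g = "\<lambda>n. \<bar>blinfun_apply (f n) (x (k j))\<bar>"] inj)
        (auto simp: strict_mono_less strict_mono_less_eq)
    then show ?thesis using Q[of j] unfolding Q_def by (meson order_trans)
  qed
  have large: "5 * \<delta> / 8 \<le> (\<Sum>i<J. blinfun_apply (f (k i)) (x (k j)))" if "j < J" for j J
  proof -
    let ?d = "\<lambda>i. blinfun_apply (f (k i)) (x (k j))"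
    have "(\<Sum>i<J. ?d i) = (\<Sum>i<j. ?d i) + ?d j + (\<Sum>i\<in>{Suc j..<J}. ?d i)"
      using sum.atLeastLessThan_concat[of 0 "Suc j" J ?d] that by (simp add: atLeast0LessThan)
    moreover have "\<bar>\<Sum>i<j. ?d i - a (k i)\<bar> \<le> \<delta> / 8" by (rule order_trans[OF sum_abs before])
    moreover have "\<bar>\<Sum>i<j. a (k i)\<bar> \<le> \<delta> / 8" by (rule order_trans[OF sum_abs sum_a])
    moreover have "\<bar>\<Sum>i\<in>{Suc j..<J}. ?d i\<bar> \<le> \<delta> / 8" by (rule order_trans[OF sum_abs after])
    ultimately show ?thesis using \<delta>(2)[of "k j"] unfolding sum_subtractf by linarith
  qed
  obtain s :: "'a \<Rightarrow>\<^sub>L real" where s: "\<And>y. (\<lambda>i. blinfun_apply (f (k i)) y) sums blinfun_apply s y"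
    using wuC_dual_sum[OF wuC_subseries[OF w inj]] by blast
  have s_large: "5 * \<delta> / 8 \<le> blinfun_apply s (x (k j))" for j
    using s[of "x (k j)"] large[of j] unfolding sums_def
    by (intro LIMSEQ_le_const) (auto intro!: exI[of _ "Suc j"])
  obtain \<phi> :: "('a \<Rightarrow>\<^sub>L real) \<Rightarrow>\<^sub>L real"
    where \<phi>: "\<And>f a. (\<lambda>j. blinfun_apply f (x (k j))) \<longlonglongrightarrow> a \<Longrightarrow> blinfun_apply \<phi> f = a"
      "\<And>f c. (\<And>j. c \<le> blinfun_apply f (x (k j))) \<Longrightarrow> c \<le> blinfun_apply \<phi> f"
    using limit_functional[of "\<lambda>j. x (k j)"] x by metis
  have "blinfun_apply \<phi> (f n) = a n" for n
    using LIMSEQ_subseq_LIMSEQ[OF lim k, of n] by (intro \<phi>(1)) (simp add: comp_def)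
  then have \<phi>_sum: "blinfun_apply \<phi> (\<Sum>i<J. f (k i)) = (\<Sum>i<J. a (k i))" for J
    by (simp add: blinfun.sum_right)
  have "(\<lambda>J. blinfun_apply (\<Sum>i<J. f (k i)) y) \<longlonglongrightarrow> blinfun_apply s y" for y
    using s[of y] unfolding sums_def by (simp add: blinfun.sum_left)
  from grothendieck_space_converges[OF G this, of \<phi>]
  have "(\<lambda>J. \<Sum>i<J. a (k i)) \<longlonglongrightarrow> blinfun_apply \<phi> s" by (simp add: \<phi>_sum)
  then have "blinfun_apply \<phi> s \<le> \<delta> / 8"
  proof (rule LIMSEQ_le_const2)
    have "(\<Sum>i<J. a (k i)) \<le> \<delta> / 8" for J
      by (rule order_trans[OF order_trans[OF abs_ge_self sum_abs] sum_a])
    then show "\<exists>N. \<forall>J\<ge>N. (\<Sum>i<J. a (k i)) \<le> \<delta> / 8" by blast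
  qed
  moreover have "5 * \<delta> / 8 \<le> blinfun_apply \<phi> s" using \<phi>(2) s_large by blast
  ultimately show False using \<delta>(1) by simp
qed

lemma almost_norming_vector:
  fixes f :: "'a::real_normed_vector \<Rightarrow>\<^sub>L real"
  assumes "c < norm f"
  obtains x where "norm x \<le> 1" "c < blinfun_apply f x"
proof -
  have "\<exists>x. norm x \<le> 1 \<and> c < blinfun_apply f x"
  proof (rule ccontr)
    assume "\<not> ?thesis"
    then have le: "blinfun_apply f x \<le> c" if "norm x \<le> 1" for x using that by force
    have "norm f \<le> c"
    proof (rule norm_blinfun_bound)
      show "0 \<le> c" using le[of 0] by simp
      fix x :: 'a
      show "norm (blinfun_apply f x) \<le> c * norm x"
      proof (cases "x = 0")
        case False
        have "blinfun_apply f (sgn x) \<le> c" "blinfun_apply f (- sgn x) \<le> c"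
          using False by (intro le; simp add: norm_sgn)+
        then have "\<bar>blinfun_apply f (sgn x)\<bar> \<le> c" by (simp add: blinfun.minus_right abs_le_iff)
        then show ?thesis using False by (simp add: sgn_div_norm blinfun.scaleR_right abs_mult field_simps)
      qed simp
    qed
    then show False using assms by simp
  qed
  then show ?thesis using that by blast
qed

text \<open>The columns of the array lie in a compact subset of the metrizable space of real
  sequences.\<close>

lemma diagonal_subsequence:
  fixes v :: "nat \<Rightarrow> nat \<Rightarrow> real"
  assumes "\<And>n k. \<bar>v n k\<bar> \<le> B n"
  obtains r a where "strict_mono r" "\<And>n. (\<lambda>k. v n (r k)) \<longlonglongrightarrow> a n"
proof -
  have "compactin (product_topology (\<lambda>_. euclidean) UNIV) (PiE UNIV (\<lambda>n. {- B n..B n}))"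
    by (auto simp: compactin_PiE)
  then have "seq_compact (PiE UNIV (\<lambda>n. {- B n..B n}))"
    by (simp add: euclidean_product_topology compact_imp_seq_compact)
  moreover have "(\<lambda>n. v n k) \<in> PiE UNIV (\<lambda>n. {- B n..B n})" for k
    using assms by (auto simp: PiE_iff abs_le_iff minus_le_iff)
  ultimately obtain a r where r: "strict_mono r" and lim: "((\<lambda>k n. v n k) \<circ> r) \<longlonglongrightarrow> a"
    unfolding seq_compact_def by metis
  have "(\<lambda>k. v n (r k)) \<longlonglongrightarrow> a n" for n
  proof -
    have "isCont (\<lambda>g :: nat \<Rightarrow> real. g n) a"
      using continuous_on_product_coordinates[of n] by (metis UNIV_I continuous_on_eq_continuous_at open_UNIV)
    from isCont_tendsto_compose[OF this lim] show ?thesis by simp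
  qed
  with r show ?thesis using that by blast
qed

theorem grothendieck_wuC_dual_norm_tendsto_0:
  fixes f :: "nat \<Rightarrow> ('a::banach \<Rightarrow>\<^sub>L real)"
  assumes G: "grothendieck_space TYPE('a)" and w: "wuC f"
  shows "(\<lambda>n. norm (f n)) \<longlonglongrightarrow> 0"
proof (rule ccontr)
  assume "\<not> ?thesis"
  then obtain e where e: "e > 0" "\<And>N. \<exists>n\<ge>N. e \<le> norm (f n)"
    unfolding LIMSEQ_iff by (auto simp: not_less)
  then have inf: "infinite {n. e \<le> norm (f n)}" by (metis (mono_tags, lifting) infinite_nat_iff_unbounded_le mem_Collect_eq)
  obtain r :: "nat \<Rightarrow> nat" where "strict_mono r" and "\<forall>n. r n \<in> {n. e \<le> norm (f n)}"
    using infinite_enumerate[OF inf] by blast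
  then have r: "strict_mono r" "\<And>n. e \<le> norm (f (r n))" by auto
  have "\<exists>x. norm x \<le> 1 \<and> e / 2 < blinfun_apply (f (r n)) x" for n
    using almost_norming_vector[of "e / 2" "f (r n)"] r(2)[of n] e(1) by (metis field_sum_of_halves less_add_same_cancel1 half_gt_zero order_less_le_trans)
  then obtain x where x: "\<And>n. norm (x n) \<le> 1" "\<And>n. e / 2 < blinfun_apply (f (r n)) (x n)" by metis
  have "\<bar>blinfun_apply (f (r n)) (x k)\<bar> \<le> norm (f (r n))" for n k
    using norm_blinfun[of "f (r n)" "x k"] mult_left_mono[OF x(1)[of k], of "norm (f (r n))"] by simp
  then obtain q a where q: "strict_mono q" and lim: "\<And>n. (\<lambda>k. blinfun_apply (f (r n)) (x (q k))) \<longlonglongrightarrow> a n"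
    using diagonal_subsequence[of "\<lambda>n k. blinfun_apply (f (r n)) (x k)" "\<lambda>n. norm (f (r n))"] by blast
  show False
  proof (rule wuC_no_uniformly_large_diagonal[OF G])
    show "wuC (\<lambda>n. f (r (q n)))"
      using strict_mono_imp_inj_on[OF strict_mono_o[OF r(1) q]] by (intro wuC_subseries[OF w, of "r \<circ> q", unfolded comp_def]) (simp add: comp_def)
    show "norm (x (q k)) \<le> 1" for k by (rule x)
    show "(\<lambda>k. blinfun_apply (f (r (q n))) (x (q k))) \<longlonglongrightarrow> a (q n)" for n by (rule lim)
    show "0 < e / 2" using e by simp
    show "e / 2 \<le> blinfun_apply (f (r (q n))) (x (q n))" for n using x(2)[of "q n"] by simp
  qed
qed

section \<open>Criteria for reflexivity\<close>

lemma norm_canonical_embedding_le: "norm (canonical_embedding x) \<le> norm x"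
proof (rule norm_blinfun_bound)
  show "norm (blinfun_apply (canonical_embedding x) f) \<le> norm x * norm f" for f
    using norm_blinfun[of f x] by (simp add: mult.commute)
qed simp

lemma bounded_linear_canonical_embedding:
  "bounded_linear (canonical_embedding :: 'a::real_normed_vector \<Rightarrow> _)"
proof (rule bounded_linear_intro)
  show "canonical_embedding (x + y) = canonical_embedding x + canonical_embedding y" for x y :: 'a
    by (rule blinfun_eqI) (simp add: blinfun.add_left blinfun.add_right)
  show "canonical_embedding (t *\<^sub>R x) = t *\<^sub>R canonical_embedding x" for t and x :: 'a
    by (rule blinfun_eqI) (simp add: blinfun.scaleR_left blinfun.scaleR_right)
  show "norm (canonical_embedding x) \<le> norm x * 1" for x :: 'a
    by (simp add: norm_canonical_embedding_le)
qed

lemma norm_canonical_embedding [simp]: "norm (canonical_embedding x) = norm x"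
proof (rule antisym)
  show "norm (canonical_embedding x) \<le> norm x" by (rule norm_canonical_embedding_le)
  obtain f where f: "blinfun_apply f x = norm x" "norm f \<le> 1" by (rule norming_functional)
  have "norm x \<le> norm (canonical_embedding x) * norm f"
    using norm_blinfun[of "canonical_embedding x" f] f(1) by simp
  also have "\<dots> \<le> norm (canonical_embedding x)" using f(2) by (simp add: mult_left_le)
  finally show "norm x \<le> norm (canonical_embedding x)" .
qed

lemma closed_range_canonical_embedding: "closed (range (canonical_embedding :: 'a::banach \<Rightarrow> _))"
proof -
  have "complete (range (canonical_embedding :: 'a \<Rightarrow> _))"
    by (rule complete_isometric_image[of 1])
      (auto simp: bounded_linear_canonical_embedding complete_UNIV)
  then show ?thesis by (rule complete_imp_closed)
qed

lemma subspace_range_canonical_embedding: "subspace (range (canonical_embedding :: 'a::real_normed_vector \<Rightarrow> _))"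
proof -
  have "linear (canonical_embedding :: 'a \<Rightarrow> _)"
    by (rule bounded_linear.linear) (rule bounded_linear_canonical_embedding)
  from linear_subspace_image[OF this subspace_UNIV] show ?thesis .
qed

text \<open>If some \<open>g\<close> vanishes on \<open>F\<close> but not at \<open>y\<close>, subtracting the multiple of
  \<open>J y\<close> that agrees with \<open>\<psi>\<close> at \<open>g\<close> reduces \<open>insert y F\<close> to \<open>F\<close>.\<close>

lemma functional_vanishing_on_annihilator:
  fixes \<psi> :: "('a::real_normed_vector \<Rightarrow>\<^sub>L real) \<Rightarrow>\<^sub>L real"
  assumes "finite F" and "\<And>f. (\<forall>x\<in>F. blinfun_apply f x = 0) \<Longrightarrow> blinfun_apply \<psi> f = 0"
  shows "\<psi> \<in> range canonical_embedding"
  using assms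
proof (induction F arbitrary: \<psi>)
  case empty
  then have "\<psi> = canonical_embedding 0" by (intro blinfun_eqI) simp
  then show ?case by blast
next
  case (insert y F)
  show ?case
  proof (cases "\<exists>g :: 'a \<Rightarrow>\<^sub>L real. (\<forall>x\<in>F. blinfun_apply g x = 0) \<and> blinfun_apply g y \<noteq> 0")
    case False
    show ?thesis
    proof (rule insert.IH)
      fix f :: "'a \<Rightarrow>\<^sub>L real" assume "\<forall>x\<in>F. blinfun_apply f x = 0"
      with False have "\<forall>x\<in>insert y F. blinfun_apply f x = 0" by blast
      then show "blinfun_apply \<psi> f = 0" by (rule insert.prems)
    qed
  next
    case True
    then obtain g :: "'a \<Rightarrow>\<^sub>L real" where g: "\<forall>x\<in>F. blinfun_apply g x = 0" "blinfun_apply g y \<noteq> 0" by blast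
    define c where "c = blinfun_apply \<psi> g / blinfun_apply g y"
    have "\<psi> - c *\<^sub>R canonical_embedding y \<in> range canonical_embedding"
    proof (rule insert.IH)
      fix f :: "'a \<Rightarrow>\<^sub>L real" assume f: "\<forall>x\<in>F. blinfun_apply f x = 0"
      define h where "h = f - (blinfun_apply f y / blinfun_apply g y) *\<^sub>R g"
      have "\<forall>x\<in>insert y F. blinfun_apply h x = 0"
        using f g by (auto simp: h_def blinfun.diff_left blinfun.scaleR_left)
      then have "blinfun_apply \<psi> h = 0" by (rule insert.prems)
      then show "blinfun_apply (\<psi> - c *\<^sub>R canonical_embedding y) f = 0"
        by (simp add: h_def c_def blinfun.diff_left blinfun.scaleR_left blinfun.diff_right blinfun.scaleR_right mult.commute)
    qed
    then have "(\<psi> - c *\<^sub>R canonical_embedding y) + c *\<^sub>R canonical_embedding y \<in> range canonical_embedding"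
      by (intro subspace_add[OF subspace_range_canonical_embedding] subspace_scale[OF subspace_range_canonical_embedding]) auto
    then show ?thesis by simp
  qed
qed

text \<open>Let \<open>\<psi>\<close> have distance at least \<open>d\<close> from the range of \<open>J\<close>, and suppose that
  \<open>\<psi> < d / 2\<close> on the unit ball of the annihilator of \<open>F\<close>.  A Hahn--Banach extension \<open>\<eta>\<close> of the restriction of
  \<open>\<psi>\<close> has norm at most \<open>d / 2\<close>, and \<open>\<psi> - \<eta>\<close> vanishes on the annihilator of a
  finite set, so it lies in the range of \<open>J\<close>, too close to \<open>\<psi>\<close>.\<close>

lemma functional_outside_canonical_image:
  fixes \<psi> :: "('a::banach \<Rightarrow>\<^sub>L real) \<Rightarrow>\<^sub>L real"
  assumes \<psi>: "\<psi> \<notin> range canonical_embedding"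
  obtains e where "e > 0"
    "\<And>F. finite F \<Longrightarrow> \<exists>f. norm f \<le> 1 \<and> (\<forall>x\<in>F. blinfun_apply f x = 0) \<and> e \<le> blinfun_apply \<psi> f"
proof -
  obtain d where d: "d > 0" "ball \<psi> d \<subseteq> - range canonical_embedding"
    using \<psi> closed_range_canonical_embedding open_contains_ball[of "- range canonical_embedding"]
    by (metis ComplI open_Compl)
  show ?thesis
  proof (rule that[of "d / 2"])
    show "d / 2 > 0" using d by simp
    fix F :: "'a set" assume F: "finite F"
    define N where "N = {f :: 'a \<Rightarrow>\<^sub>L real. \<forall>x\<in>F. blinfun_apply f x = 0}"
    have N: "subspace N"
      by (auto simp: N_def subspace_def blinfun.add_left blinfun.scaleR_left)
    show "\<exists>f. norm f \<le> 1 \<and> (\<forall>x\<in>F. blinfun_apply f x = 0) \<and> d / 2 \<le> blinfun_apply \<psi> f"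
    proof (rule ccontr)
      assume no: "\<not> ?thesis"
      have le: "blinfun_apply \<psi> f \<le> d / 2 * norm f" if "f \<in> N" for f
      proof (cases "f = 0")
        case False
        have "sgn f \<in> N" using N that by (auto simp: sgn_div_norm intro: subspace_scale)
        then have "blinfun_apply \<psi> (sgn f) < d / 2"
          using no False by (force simp: N_def norm_sgn)
        then show ?thesis using False by (simp add: sgn_div_norm blinfun.scaleR_right field_simps)
      qed simp
      obtain \<eta> where \<eta>: "\<And>f. f \<in> N \<Longrightarrow> blinfun_apply \<eta> f = blinfun_apply \<psi> f" "norm \<eta> \<le> d / 2"
        by (rule hahn_banach_extension[OF N _ _ le])
          (use d in \<open>auto simp: blinfun.add_right blinfun.scaleR_right\<close>)
      have "\<psi> - \<eta> \<in> range canonical_embedding"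
        by (rule functional_vanishing_on_annihilator[OF F])
          (use \<eta>(1) in \<open>auto simp: N_def blinfun.diff_left\<close>)
      moreover have "\<psi> - \<eta> \<in> ball \<psi> d" using \<eta>(2) d(1) by (simp add: dist_norm)
      ultimately show False using d(2) by blast
    qed
  qed
qed

text \<open>Compactness upgrades finite sets to the whole space: for \<open>\<psi>\<close> outside the range of
  \<open>J\<close> it would produce a functional that vanishes everywhere although \<open>\<psi>\<close> is positive on it.\<close>

theorem reflexive_if_dual_ball_relatively_weakly_compact:
  assumes K: "relatively_weakly_compact {f :: 'a::banach \<Rightarrow>\<^sub>L real. norm f \<le> 1}"
  shows "reflexive_space TYPE('a)"
proof (rule ccontr)
  assume "\<not> ?thesis"
  then obtain \<psi> :: "('a \<Rightarrow>\<^sub>L real) \<Rightarrow>\<^sub>L real" where "\<psi> \<notin> range canonical_embedding"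
    unfolding reflexive_space_def by blast
  then obtain e where e: "e > 0"
    "\<And>F. finite F \<Longrightarrow> \<exists>f. norm f \<le> 1 \<and> (\<forall>x\<in>F. blinfun_apply f x = 0) \<and> e \<le> blinfun_apply \<psi> f"
    using functional_outside_canonical_image by blast
  define \<phi> where "\<phi> i = (case i of None \<Rightarrow> \<psi> | Some x \<Rightarrow> canonical_embedding x)" for i :: "'a option"
  define S where "S i = (case i of None \<Rightarrow> {e..} | Some x \<Rightarrow> {0})" for i :: "'a option"
  have "\<exists>g. \<forall>i. blinfun_apply (\<phi> i) g \<in> S i"
  proof (rule relatively_weakly_compact_fip[OF K, where I = UNIV and S = S and \<phi> = \<phi>])
    show "closed (S i)" for i by (auto simp: S_def split: option.split)
    fix J :: "'a option set" assume "finite J"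
    then have "finite {x. Some x \<in> J}" by (rule finite_vimageI[of J Some, unfolded vimage_def]) simp
    then obtain f where f: "norm f \<le> 1" "\<forall>x\<in>{x. Some x \<in> J}. blinfun_apply f x = 0" "e \<le> blinfun_apply \<psi> f"
      using e(2) by blast
    then have "blinfun_apply (\<phi> i) f \<in> S i" if "i \<in> J" for i
      using that by (cases i) (auto simp: \<phi>_def S_def)
    then show "\<exists>k\<in>{f. norm f \<le> 1}. \<forall>i\<in>J. blinfun_apply (\<phi> i) k \<in> S i" using f(1) by blast
  qed blast
  then obtain g where g: "\<And>i. blinfun_apply (\<phi> i) g \<in> S i" by blast
  have "g = 0"
    using g[of "Some _"] by (intro blinfun_eqI) (simp add: \<phi>_def S_def)
  then show False using g[of None] e(1) by (simp add: \<phi>_def S_def)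
qed

text \<open>Vanishing on longer and longer finite pieces of a dense sequence makes bounded functionals
  weak* null, while \<open>\<psi>\<close> keeps them from being weakly null.\<close>

theorem reflexive_if_grothendieck_separable:
  assumes G: "grothendieck_space TYPE('a::banach)" and sep: "separable_space (euclidean :: 'a topology)"
  shows "reflexive_space TYPE('a)"
proof (rule ccontr)
  assume "\<not> ?thesis"
  then obtain \<psi> :: "('a \<Rightarrow>\<^sub>L real) \<Rightarrow>\<^sub>L real" where "\<psi> \<notin> range canonical_embedding"
    unfolding reflexive_space_def by blast
  then obtain e where e: "e > 0"
    "\<And>F. finite F \<Longrightarrow> \<exists>f. norm f \<le> 1 \<and> (\<forall>x\<in>F. blinfun_apply f x = 0) \<and> e \<le> blinfun_apply \<psi> f"
    using functional_outside_canonical_image by blast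
  obtain C :: "'a set" where C: "countable C" "closure C = UNIV"
    using sep unfolding separable_space_def by auto
  then have "C \<noteq> {}" by auto
  define c where "c = from_nat_into C"
  have c: "range c = C" unfolding c_def using \<open>C \<noteq> {}\<close> C(1) by (rule range_from_nat_into)
  have "\<exists>f. norm f \<le> 1 \<and> (\<forall>x\<in>c ` {..n}. blinfun_apply f x = 0) \<and> e \<le> blinfun_apply \<psi> f" for n
    by (rule e(2)) simp
  then obtain f where f: "\<And>n. norm (f n) \<le> 1" "\<And>n i. i \<le> n \<Longrightarrow> blinfun_apply (f n) (c i) = 0"
      "\<And>n. e \<le> blinfun_apply \<psi> (f n)"
    by (metis atMost_iff imageI)
  have "(\<lambda>n. blinfun_apply (f n) x) \<longlonglongrightarrow> blinfun_apply 0 x" for x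
  proof (rule metric_LIMSEQ_I)
    fix r :: real assume "r > 0"
    then obtain i where i: "dist (c i) x < r"
      using C(2) c closure_approachable[of x C] by (metis UNIV_I rangeE)
    have "dist (blinfun_apply (f n) x) (blinfun_apply 0 x) < r" if "n \<ge> i" for n
    proof -
      have "\<bar>blinfun_apply (f n) (x - c i)\<bar> \<le> norm (f n) * norm (x - c i)" using norm_blinfun[of "f n" "x - c i"] by simp
      also have "\<dots> \<le> norm (x - c i)" using f(1)[of n] by (simp add: mult_left_le_one_le)
      also have "\<dots> < r" using i by (simp add: dist_norm norm_minus_commute)
      finally show ?thesis using f(2)[OF that] by (simp add: blinfun.diff_right)
    qed
    then show "\<exists>i. \<forall>n\<ge>i. dist (blinfun_apply (f n) x) (blinfun_apply 0 x) < r" by blast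
  qed
  from grothendieck_space_converges[OF G this, of \<psi>]
  have "e \<le> blinfun_apply \<psi> 0" by (rule LIMSEQ_le_const) (use f(3) in blast)
  then show False using e(1) by simp
qed

text \<open>Otherwise a functional on the bidual separates the closed range of \<open>J\<close> from a point; by
  reflexivity of the dual it is evaluation at some \<open>g\<close>, and \<open>g\<close> vanishes everywhere.\<close>

theorem reflexive_if_dual_reflexive:
  assumes "reflexive_space TYPE('a::banach \<Rightarrow>\<^sub>L real)"
  shows "reflexive_space TYPE('a)"
proof (rule ccontr)
  assume "\<not> ?thesis"
  then obtain \<psi> :: "('a \<Rightarrow>\<^sub>L real) \<Rightarrow>\<^sub>L real" where \<psi>: "\<psi> \<notin> range canonical_embedding"
    unfolding reflexive_space_def by blast
  obtain \<Phi> :: "(('a \<Rightarrow>\<^sub>L real) \<Rightarrow>\<^sub>L real) \<Rightarrow>\<^sub>L real"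
    where \<Phi>: "\<forall>\<eta>\<in>range canonical_embedding. blinfun_apply \<Phi> \<eta> = 0" "blinfun_apply \<Phi> \<psi> = 1"
    using functional_vanishing_on_subspace[OF subspace_range_canonical_embedding closed_range_canonical_embedding \<psi>] by blast
  obtain g where g: "\<Phi> = canonical_embedding g"
    using assms unfolding reflexive_space_def by (metis surjD)
  have "g = 0" using \<Phi>(1) by (intro blinfun_eqI) (auto simp: g)
  then show False using \<Phi>(2) by (simp add: g)
qed

section \<open>Properties (V) and (V*)\<close>

lemma tendsto_0_ennreal_upper:
  assumes "v \<longlonglongrightarrow> 0" "\<And>n. u n \<le> ennreal (v n)"
  shows "u \<longlonglongrightarrow> 0"
proof (rule tendsto_sandwich[where f = "\<lambda>_. 0" and h = "\<lambda>n. ennreal (v n)"])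
  show "(\<lambda>n. ennreal (v n)) \<longlonglongrightarrow> 0" using tendsto_ennrealI[OF assms(1)] by simp
qed (use assms(2) in auto)

theorem grothendieck_if_dual_grothendieck_property_V:
  assumes G: "grothendieck_space TYPE('a::banach \<Rightarrow>\<^sub>L real)" and V: "property_V TYPE('a)"
  shows "grothendieck_space TYPE('a)"
proof (rule grothendieck_spaceI)
  fix f :: "nat \<Rightarrow> ('a \<Rightarrow>\<^sub>L real)" and l and \<phi> :: "('a \<Rightarrow>\<^sub>L real) \<Rightarrow>\<^sub>L real"
  assume lim: "\<And>x. (\<lambda>n. blinfun_apply (f n) x) \<longlonglongrightarrow> blinfun_apply l x"
  have "\<exists>B. \<forall>h\<in>range f. \<bar>blinfun_apply h x\<bar> \<le> B" for x
    using convergent_imp_Bseq[OF convergentI[OF lim[of x]]] by (auto simp: Bseq_def)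
  then obtain B where B: "\<And>n. norm (f n) \<le> B"
    using uniform_boundedness[of "range f"] by (auto simp: bounded_iff)
  have "relatively_weakly_compact (range f)"
  proof (rule V[unfolded property_V_def, rule_format])
    fix x :: "nat \<Rightarrow> 'a" assume x: "wuC x"
    have "wuC (\<lambda>n. canonical_embedding (x n))"
      unfolding wuC_def
    proof
      fix \<Phi> :: "(('a \<Rightarrow>\<^sub>L real) \<Rightarrow>\<^sub>L real) \<Rightarrow>\<^sub>L real"
      have "bounded_linear (\<lambda>y. blinfun_apply \<Phi> (canonical_embedding y))"
        by (rule bounded_linear_compose[OF blinfun.bounded_linear_right bounded_linear_canonical_embedding])
      from x[unfolded wuC_def, rule_format, of "Blinfun (\<lambda>y. blinfun_apply \<Phi> (canonical_embedding y))"]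
      show "summable (\<lambda>n. \<bar>blinfun_apply \<Phi> (canonical_embedding (x n))\<bar>)"
        by (simp add: bounded_linear_Blinfun_apply[OF \<open>bounded_linear _\<close>])
    qed
    from grothendieck_wuC_dual_norm_tendsto_0[OF G this]
    have x0: "(\<lambda>n. norm (x n)) \<longlonglongrightarrow> 0" by simp
    have "(\<lambda>n. B * norm (x n)) \<longlonglongrightarrow> 0" using tendsto_mult_left[OF x0, of B] by simp
    moreover have "(SUP g\<in>range f. ennreal \<bar>blinfun_apply g (x n)\<bar>) \<le> ennreal (B * norm (x n))" for n
    proof (rule SUP_least)
      fix g assume "g \<in> range f"
      then show "ennreal \<bar>blinfun_apply g (x n)\<bar> \<le> ennreal (B * norm (x n))"
        using norm_blinfun[of g "x n"] B mult_right_mono[of "norm g" B "norm (x n)"]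
        by (intro ennreal_leI) auto
    qed
    ultimately show "(\<lambda>n. SUP g\<in>range f. ennreal \<bar>blinfun_apply g (x n)\<bar>) \<longlonglongrightarrow> 0"
      by (intro tendsto_0_ennreal_upper)
  qed
  then show "(\<lambda>n. blinfun_apply \<phi> (f n)) \<longlonglongrightarrow> blinfun_apply \<phi> l"
    using lim by (rule weak_limit_if_relatively_weakly_compact)
qed

theorem reflexive_if_dual_grothendieck_property_V_star:
  assumes G: "grothendieck_space TYPE('a::banach \<Rightarrow>\<^sub>L real)" and V: "property_V_star TYPE('a \<Rightarrow>\<^sub>L real)"
  shows "reflexive_space TYPE('a)"
proof (rule reflexive_if_dual_ball_relatively_weakly_compact)
  show "relatively_weakly_compact {f :: 'a \<Rightarrow>\<^sub>L real. norm f \<le> 1}"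
  proof (rule V[unfolded property_V_star_def, rule_format])
    fix f :: "nat \<Rightarrow> (('a \<Rightarrow>\<^sub>L real) \<Rightarrow>\<^sub>L real)" assume "wuC f"
    from grothendieck_wuC_dual_norm_tendsto_0[OF G this]
    have "(\<lambda>n. norm (f n)) \<longlonglongrightarrow> 0" .
    moreover have "(SUP x\<in>{g. norm g \<le> 1}. ennreal \<bar>blinfun_apply (f n) x\<bar>) \<le> ennreal (norm (f n))" for n
    proof (rule SUP_least)
      fix x :: "'a \<Rightarrow>\<^sub>L real" assume "x \<in> {g. norm g \<le> 1}"
      then show "ennreal \<bar>blinfun_apply (f n) x\<bar> \<le> ennreal (norm (f n))"
        using norm_blinfun[of "f n" x] mult_left_mono[of "norm x" 1 "norm (f n)"]
        by (intro ennreal_leI) auto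
    qed
    ultimately show "(\<lambda>n. SUP x\<in>{g. norm g \<le> 1}. ennreal \<bar>blinfun_apply (f n) x\<bar>) \<longlonglongrightarrow> 0"
      by (intro tendsto_0_ennreal_upper)
  qed
qed

section \<open>The dual as a complemented subspace of the Lipschitz functions\<close>

lemma additive_bounded_imp_homogeneous:
  fixes g :: "'a::real_normed_vector \<Rightarrow> real"
  assumes add: "\<And>x y. g (x + y) = g x + g y" and bound: "\<And>x. \<bar>g x\<bar> \<le> C * norm x"
  shows "g (t *\<^sub>R x) = t * g x"
proof -
  have nat: "g (real n *\<^sub>R y) = real n * g y" for n y
  proof (induction n)
    case 0
    show ?case using add[of 0 0] by simp
  next
    case (Suc n)
    then show ?case using add[of "real n *\<^sub>R y" y] by (simp add: algebra_simps)
  qed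
  have neg: "g (- y) = - g y" for y using add[of y "- y"] nat[of 0 y] by simp
  have int: "g (of_int m *\<^sub>R y) = of_int m * g y" for m y
    by (cases m rule: int_cases2) (simp_all add: nat neg)
  \<comment> \<open>The defect \<open>h\<close> of homogeneity is additive and vanishes at the integers, so it is
    bounded by its values on the unit interval; a bounded additive function is 0.\<close>
  define h where "h s = g (s *\<^sub>R x) - s * g x" for s
  have C: "0 \<le> C * norm x" using bound[of x] by linarith
  have h_bound: "\<bar>h s\<bar> \<le> 2 * (C * norm x)" for s
  proof -
    have "g (s *\<^sub>R x) = g (of_int \<lfloor>s\<rfloor> *\<^sub>R x) + g (frac s *\<^sub>R x)"
      unfolding add[symmetric] scaleR_add_left[symmetric] by (simp add: frac_def)
    then have "h s = h (frac s)" by (simp add: h_def int frac_def algebra_simps)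
    also have "\<bar>h (frac s)\<bar> \<le> \<bar>g (frac s *\<^sub>R x)\<bar> + \<bar>frac s * g x\<bar>" unfolding h_def by (rule abs_triangle_ineq4)
    also have "\<bar>g (frac s *\<^sub>R x)\<bar> \<le> C * norm x"
    proof -
      have "\<bar>g (frac s *\<^sub>R x)\<bar> \<le> frac s * (C * norm x)" using bound[of "frac s *\<^sub>R x"] by (simp add: ac_simps)
      also have "\<dots> \<le> C * norm x" using C frac_lt_1[of s] by (intro mult_left_le_one_le) auto
      finally show ?thesis .
    qed
    also have "\<bar>frac s * g x\<bar> \<le> 1 * (C * norm x)"
      unfolding abs_mult using bound[of x] frac_lt_1[of s] by (intro mult_mono) auto
    finally show ?thesis by simp
  qed
  have "real n * \<bar>h t\<bar> \<le> 2 * (C * norm x)" for n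
    using h_bound[of "real n * t"] nat[of n "t *\<^sub>R x"]
    by (simp add: h_def abs_mult right_diff_distrib[symmetric] mult.assoc)
  then have "h t = 0"
    using reals_Archimedean3[of "\<bar>h t\<bar>"] by (metis abs_zero linorder_not_less zero_less_abs_iff)
  then show ?thesis by (simp add: h_def)
qed

text \<open>Weak* convergence is preserved by composing with the projection \<open>P\<close>; weak convergence is
  preserved by restricting back along \<open>i\<close>.\<close>

lemma grothendieck_complemented:
  fixes i :: "'a::banach \<Rightarrow>\<^sub>L 'b::banach" and P :: "'b \<Rightarrow>\<^sub>L 'a"
  assumes G: "grothendieck_space TYPE('b)" and P: "\<And>x. blinfun_apply P (blinfun_apply i x) = x"
  shows "grothendieck_space TYPE('a)"
proof (rule grothendieck_spaceI)
  fix f :: "nat \<Rightarrow> ('a \<Rightarrow>\<^sub>L real)" and l and \<phi> :: "('a \<Rightarrow>\<^sub>L real) \<Rightarrow>\<^sub>L real"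
  assume lim: "\<And>x. (\<lambda>n. blinfun_apply (f n) x) \<longlonglongrightarrow> blinfun_apply l x"
  define \<psi> :: "('b \<Rightarrow>\<^sub>L real) \<Rightarrow>\<^sub>L real" where "\<psi> = Blinfun (\<lambda>g. blinfun_apply \<phi> (g o\<^sub>L i))"
  have "bounded_linear (\<lambda>g :: 'b \<Rightarrow>\<^sub>L real. blinfun_apply \<phi> (g o\<^sub>L i))"
    by (rule bounded_linear_compose[OF blinfun.bounded_linear_right
        bounded_bilinear.bounded_linear_left[OF bounded_bilinear_blinfun_compose]])
  then have \<psi>: "blinfun_apply \<psi> g = blinfun_apply \<phi> (g o\<^sub>L i)" for g
    by (simp add: \<psi>_def bounded_linear_Blinfun_apply)
  have pull: "blinfun_apply \<psi> (g o\<^sub>L P) = blinfun_apply \<phi> g" for g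
  proof -
    have "(g o\<^sub>L P) o\<^sub>L i = g" by (rule blinfun_eqI) (simp add: P)
    then show ?thesis by (simp add: \<psi>)
  qed
  have "(\<lambda>n. blinfun_apply (f n o\<^sub>L P) y) \<longlonglongrightarrow> blinfun_apply (l o\<^sub>L P) y" for y
    using lim by simp
  from grothendieck_space_converges[OF G this, of \<psi>]
  show "(\<lambda>n. blinfun_apply \<phi> (f n)) \<longlonglongrightarrow> blinfun_apply \<phi> l" by (simp add: pull)
qed

lemma dual_inclusion_lip0:
  obtains i :: "('a::real_normed_vector \<Rightarrow>\<^sub>L real) \<Rightarrow>\<^sub>L 'a lip0"
  where "\<And>f. lip0_apply (blinfun_apply i f) = blinfun_apply f"
proof -
  have lip: "(norm f)-lipschitz_on UNIV (blinfun_apply f)" for f :: "'a \<Rightarrow>\<^sub>L real"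
  proof (rule lipschitz_onI)
    show "dist (blinfun_apply f x) (blinfun_apply f y) \<le> norm f * dist x y" for x y
      using norm_blinfun[of f "x - y"] by (simp add: dist_norm blinfun.diff_right)
  qed simp
  define I where "I f = Lip0 (blinfun_apply f)" for f :: "'a \<Rightarrow>\<^sub>L real"
  have I: "lip0_apply (I f) = blinfun_apply f" for f
    unfolding I_def using lip[of f] by (intro Lip0_inverse) auto
  have "bounded_linear I"
  proof (rule bounded_linear_intro)
    show "I (f + g) = I f + I g" for f g
      by (simp add: lip0_apply_inject[symmetric] plus_lip0.rep_eq I blinfun.add_left fun_eq_iff)
    show "I (t *\<^sub>R f) = t *\<^sub>R I f" for t f
      by (simp add: lip0_apply_inject[symmetric] scaleR_lip0.rep_eq I blinfun.scaleR_left fun_eq_iff)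
    show "norm (I f) \<le> norm f * 1" for f
      using norm_lip0_least[of "norm f" "I f"] lip[of f] by (simp add: I)
  qed
  then show ?thesis using that[of "Blinfun I"] I by (simp add: bounded_linear_Blinfun_apply)
qed

text \<open>The difference \<open>D f x\<close> is bounded even though \<open>f\<close> is not, so an invariant mean can be
  applied to it.  Additivity in \<open>x\<close> is the cocycle identity
  \<open>D f (x + z) y = D f x (y + z) + D f z y\<close> combined with invariance.\<close>

theorem dual_complemented_in_lip0:
  obtains i :: "('a::real_normed_vector \<Rightarrow>\<^sub>L real) \<Rightarrow>\<^sub>L 'a lip0" and P :: "'a lip0 \<Rightarrow>\<^sub>L ('a \<Rightarrow>\<^sub>L real)"
  where "\<And>f. blinfun_apply P (blinfun_apply i f) = f"
proof -
  obtain i :: "('a \<Rightarrow>\<^sub>L real) \<Rightarrow>\<^sub>L 'a lip0"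
    where i: "\<And>f. lip0_apply (blinfun_apply i f) = blinfun_apply f"
    by (rule dual_inclusion_lip0) blast
  obtain M :: "('a \<Rightarrow> real) \<Rightarrow> real"
    where M: "is_mean M" and inv: "\<And>h z. bounded (range h) \<Longrightarrow> M (\<lambda>y. h (y + z)) = M h"
    using invariant_mean_exists by blast
  define D where "D f x = (\<lambda>y. lip0_apply f (y + x) - lip0_apply f y)" for f :: "'a lip0" and x
  define g where "g f x = M (D f x)" for f x
  have D: "\<bar>D f x y\<bar> \<le> norm f * norm x" for f x y
    using norm_lip0_upper[of f "y + x" y] by (simp add: D_def dist_norm)
  then have bdd: "bounded (range (D f x))" for f x unfolding bounded_range_real by blast
  have g_bound: "\<bar>g f x\<bar> \<le> norm f * norm x" for f x
    unfolding g_def by (rule mean_abs_le[OF M D])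
  have g_add: "g f (x + z) = g f x + g f z" for f x z
  proof -
    have "D f (x + z) = (\<lambda>y. D f x (y + z) + D f z y)" by (auto simp: D_def ac_simps)
    moreover have "bounded (range (\<lambda>y. D f x (y + z)))" using D unfolding bounded_range_real by blast
    ultimately have "g f (x + z) = M (\<lambda>y. D f x (y + z)) + g f z"
      unfolding g_def using mean_add[OF M _ bdd] by simp
    then show ?thesis using inv[OF bdd, of f x z] by (simp add: g_def)
  qed
  have g_scale: "g f (t *\<^sub>R x) = t * g f x" for f t x
    by (rule additive_bounded_imp_homogeneous[OF g_add g_bound])
  have bl: "bounded_linear (g f)" for f
    by (rule bounded_linear_intro[of _ "norm f"]) (use g_add g_scale g_bound in \<open>auto simp: mult.commute\<close>)
  define Q where "Q f = Blinfun (g f)" for f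
  have Q: "blinfun_apply (Q f) = g f" for f unfolding Q_def by (rule bounded_linear_Blinfun_apply[OF bl])
  have "bounded_linear Q"
  proof (rule bounded_linear_intro)
    show "Q (f + h) = Q f + Q h" for f h
    proof (rule blinfun_eqI)
      fix x
      have "D (f + h) x = (\<lambda>y. D f x y + D h x y)" by (auto simp: D_def plus_lip0.rep_eq)
      then show "blinfun_apply (Q (f + h)) x = blinfun_apply (Q f + Q h) x"
        using mean_add[OF M bdd bdd] by (simp add: Q g_def blinfun.add_left)
    qed
    show "Q (t *\<^sub>R f) = t *\<^sub>R Q f" for t f
    proof (rule blinfun_eqI)
      fix x
      have "D (t *\<^sub>R f) x = (\<lambda>y. t * D f x y)" by (auto simp: D_def scaleR_lip0.rep_eq algebra_simps)
      then show "blinfun_apply (Q (t *\<^sub>R f)) x = blinfun_apply (t *\<^sub>R Q f) x"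
        using mean_scale[OF M bdd] by (simp add: Q g_def blinfun.scaleR_left)
    qed
    show "norm (Q f) \<le> norm f * 1" for f
      using g_bound by (intro norm_blinfun_bound) (auto simp: Q)
  qed
  moreover have "Q (blinfun_apply i f) = f" for f
  proof (rule blinfun_eqI)
    fix x
    have "D (blinfun_apply i f) x = (\<lambda>_. blinfun_apply f x)" by (auto simp: D_def i blinfun.add_right)
    then show "blinfun_apply (Q (blinfun_apply i f)) x = blinfun_apply f x"
      by (simp add: Q g_def mean_const[OF M])
  qed
  ultimately show ?thesis using that[of "Blinfun Q" i] by (simp add: bounded_linear_Blinfun_apply)
qed

theorem dual_grothendieck_if_lip0_grothendieck:
  assumes "grothendieck_space TYPE('a::banach lip0)"
  shows "grothendieck_space TYPE('a \<Rightarrow>\<^sub>L real)"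
proof -
  obtain i :: "('a \<Rightarrow>\<^sub>L real) \<Rightarrow>\<^sub>L 'a lip0" and P :: "'a lip0 \<Rightarrow>\<^sub>L ('a \<Rightarrow>\<^sub>L real)"
    where "\<And>f. blinfun_apply P (blinfun_apply i f) = f"
    using dual_complemented_in_lip0 by blast
  then show ?thesis by (rule grothendieck_complemented[OF assms])
qed

section \<open>Lipschitz spaces that are not Grothendieck\<close>

theorem proposition5p14:
  assumes "(property_V TYPE('e::banach) \<and> \<not> grothendieck_space TYPE('e))
    \<or> (\<not> reflexive_space TYPE('e) \<and> property_V_star TYPE('e \<Rightarrow>\<^sub>L real))
    \<or> (\<not> reflexive_space TYPE('e) \<and>
        separable_space (euclidean :: ('e \<Rightarrow>\<^sub>L real) topology))"
  shows "\<not> grothendieck_space TYPE('e lip0)"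
proof
  assume "grothendieck_space TYPE('e lip0)"
  then have "grothendieck_space TYPE('e \<Rightarrow>\<^sub>L real)"
    by (rule dual_grothendieck_if_lip0_grothendieck)
  with assms show False
    using grothendieck_if_dual_grothendieck_property_V reflexive_if_dual_grothendieck_property_V_star
      reflexive_if_grothendieck_separable reflexive_if_dual_reflexive by metis
qed

end
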